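(* 1) Every dual pencil type projective billiard on a conic $C\subset\mathbb{R}^2_{x_1,x_2}=\{x_3=1\}\subset\mathbb{R}^3$ punctured in the (at most four) base points is given by a transversal line field $\mathcal{N}$ defined by a real symmetric $3\times3$-matrix $\mathcal{A}$ as follows: for every $x\in C^o$ (the punctured conic) the line $\mathcal{N}(x)$ is defined by the condition that the two-dimensional subspaces $H_C(x)$ and $H_{\mathcal{N}}(x)$ of $\mathbb{R}^3$ are $\mathcal{A}$-orthogonal, i.e. orthogonal with respect to the scalar product $\langle\mathcal{A}x,x\rangle$. 2) Statement 1) holds for every real matrix $\mathcal{A}$ such that the complex conic $\alpha_{\mathcal{A}}:=\{\langle\mathcal{A}x,x\rangle=0\}\subset\mathbb{CP}^2$ lies in the dual pencil defining the projective billiard and is different from $C$. In particular, the matrix $\mathcal{A}$ can be chosen non-degenerate. 3) Up to projective transformation and restriction to a finite union of open arcs, every dual pencil type projective billiard is the projection of a billiard on a surface of constant curvature. That is, there exist a real projective transformation $F$ of $\mathbb{RP}^2$, a non-empty finite union $C'\subset C^o$ of open arcs, a surface $\Sigma$ of constant curvature from the list in the context and a curve $\widetilde C'\subset\Sigma$ projected bijectively by the tautological projection $\pi$ onto $F(C')$, such that $d\pi$ sends the normal line field of $\widetilde C'$ in $\Sigma$ to the image under $F$ of the line field $\mathcal{N}|_{C'}$.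
   Context: Identify $\mathbb{R}^2_{x_1,x_2}$ with the plane $\{x_3=1\}\subset\mathbb{R}^3$ and with the affine chart $\{x_3\neq0\}\subset\mathbb{RP}^2_{[x_1:x_2:x_3]}\subset\mathbb{CP}^2$; $\langle\ ,\ \rangle$ is the standard Euclidean scalar product (extended complex-bilinearly). Let $\pi:\mathbb{R}^3\setminus\{0\}\to\mathbb{RP}^2$ be the tautological projection. Projective billiard. A planar projective billiard is a curve $C$ with a transversal line field $\mathcal{N}$; the reflection at $Q\in C$ is the projectivization of the linear involution of $T_Q\mathbb{R}^2$ with eigenlines $T_QC$, $\mathcal{N}(Q)$ and eigenvalues $1$, $-1$. Dual pencil type billiards. Let $C\subset\mathbb{R}^2$ be a nonlinear, non-single-point real conic, and $S\ne C$ a (regular) complex conic in $\mathbb{CP}^2$ defined by a real quadratic equation. Let $\mathcal{B}\subset C$ be the set of base points: those $X\in C$ for which the complex tangent line to $C$ at $X$ is also tangent to $S$; it has at most four points. Put $C^o=C\setminus\mathcal{B}$. For $Q\in C^o$ consider the linear involution of $T_Q\mathbb{R}^2$ having $T_QC$ as eigenline with eigenvalue $1$ and whose complexification permutes the complex lines through $Q$ tangent to $S$; let $\mathcal{N}(Q)$ be its (real) eigenline with eigenvalue $-1$. The projective billiard on $C^o$ given by $\mathcal{N}$ is called a dual pencil type projective billiard. Dual pencil. Let the dual conics of $C$ and $S$ under the orthogonal polarity be $C^*=\{\langle UM,M\rangle=0\}$ and $S^*=\{\langle AM,M\rangle=0\}$ with $U,A$ real symmetric $3\times3$-matrices. The dual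 pencil defining the billiard consists of the conics $\{\langle(U-\lambda A)^{-1}x,x\rangle=0\}$, $\lambda\in\overline{\mathbb{C}}=\mathbb{C}\cup\{\infty\}$, for those $\lambda$ for which $U-\lambda A$ is invertible ($\lambda=\infty$ giving $\{\langle A^{-1}x,x\rangle=0\}=S$, and $\lambda=0$ giving $C$). Subspaces. For $x\in C$, $H_C(x)\subset\mathbb{R}^3$ is the two-dimensional vector subspace containing the line $T_xC\subset\{x_3=1\}$, and $H_{\mathcal{N}}(x)$ is the two-dimensional vector subspace containing the line $\mathcal{N}(x)\subset\{x_3=1\}$. These two planes are $\mathcal{A}$-orthogonal if $H_{\mathcal{N}}(x)$ contains the $\mathcal{A}$-orthogonal complement $\{v:\langle\mathcal{A}v,w\rangle=0\ \forall w\in H_C(x)\}$ of $H_C(x)$. Surfaces of constant curvature. $\Sigma$ is one of: the plane $\{x_3=1\}$ with metric $dx_1^2+dx_2^2$; the unit sphere $\{x_1^2+x_2^2+x_3^2=1\}$ with metric induced by $dx_1^2+dx_2^2+dx_3^2$; the hyperbolic plane $\{x_3^2-x_1^2-x_2^2=1,\ x_3>0\}$ with metric induced by $dx_1^2+dx_2^2-dx_3^2$. The normal line field on a curve in $\Sigma$ is taken with respect to the metric of $\Sigma$; its image under $d\pi$ is a projective billiard structure on the projected curve, and this projective billiard is called the projection of the billiard in $\Sigma$. *)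

theory Defs
  imports "HOL-Analysis.Analysis"
begin

section \<open>Conics in homogeneous coordinates\<close>

text \<open>
  The plane \<open>x\<^sub>3 = 1\<close> is \<^typ>\<open>real^2\<close>, embedded in \<^typ>\<open>real^3\<close> by \<open>hvec\<close>; \<open>dvec\<close> is the
  differential of \<open>hvec\<close>. Subsets of the complex projective plane are given by their
  homogeneous coordinates, i.e. as subsets of \<open>complex^3 - {0}\<close> stable under scaling, and
  projective lines by two-dimensional vector subspaces.
\<close>

definition hvec :: "'a::zero_neq_one^2 \<Rightarrow> 'a^3" where
  "hvec x = vector [x$1, x$2, 1]"

definition dvec :: "'a::zero^2 \<Rightarrow> 'a^3" where
  "dvec v = vector [v$1, v$2, 0]"

definition cvec :: "real^'n \<Rightarrow> complex^'n" where
  "cvec x = (\<chi> i. complex_of_real (x$i))"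

definition cmat :: "real^'n^'m \<Rightarrow> complex^'n^'m" where
  "cmat M = (\<chi> i j. complex_of_real (M$i$j))"

text \<open>Complex-bilinear (not Hermitian) extension of the Euclidean scalar product.\<close>

definition cdot :: "complex^'n \<Rightarrow> complex^'n \<Rightarrow> complex" where
  "cdot v w = (\<Sum>i\<in>UNIV. v$i * w$i)"

definition symmetric_matrix :: "'a^'n^'n \<Rightarrow> bool" where
  "symmetric_matrix M \<longleftrightarrow> transpose M = M"

definition regular_conic_matrix :: "real^3^3 \<Rightarrow> bool" where
  "regular_conic_matrix M \<longleftrightarrow> symmetric_matrix M \<and> invertible M"

definition complex_conic :: "complex^3^3 \<Rightarrow> (complex^3) set" where
  "complex_conic M = {v. v \<noteq> 0 \<and> cdot (M *v v) v = 0}"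

definition affine_conic :: "real^3^3 \<Rightarrow> (real^2) set" where
  "affine_conic M = {x. (M *v hvec x) \<bullet> hvec x = 0}"

text \<open>
  A real conic that is neither empty, nor a point, nor contained in a union of lines is the
  set of real points of a regular conic; conversely, the real affine part of a regular conic
  is infinite and contained in no union of two lines as soon as it is nonempty.
\<close>

definition nonlinear_real_conic :: "real^3^3 \<Rightarrow> bool" where
  "nonlinear_real_conic M \<longleftrightarrow> regular_conic_matrix M \<and> affine_conic M \<noteq> {}"

text \<open>Tangent lines are kernels of the differential \<open>w \<mapsto> 2 \<langle>M y, w\<rangle>\<close> of the quadratic form.\<close>

definition complex_tangent :: "real^3^3 \<Rightarrow> complex^3 \<Rightarrow> (complex^3) set" where
  "complex_tangent M y = {w. cdot (cmat M *v y) w = 0}"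

definition is_tangent_to :: "(complex^3) set \<Rightarrow> real^3^3 \<Rightarrow> bool" where
  "is_tangent_to L M \<longleftrightarrow> (\<exists>y\<in>complex_conic (cmat M). L = complex_tangent M y)"

definition affine_tangent :: "real^3^3 \<Rightarrow> real^2 \<Rightarrow> (real^2) set" where
  "affine_tangent M x = {z. (M *v hvec x) \<bullet> hvec z = 0}"

definition tangent_direction :: "real^3^3 \<Rightarrow> real^2 \<Rightarrow> (real^2) set" where
  "tangent_direction M x = {v. (M *v hvec x) \<bullet> dvec v = 0}"


section \<open>Dual pencil type billiards\<close>

definition base_points :: "real^3^3 \<Rightarrow> real^3^3 \<Rightarrow> (real^2) set" where
  "base_points C S =
     {x \<in> affine_conic C. is_tangent_to (complex_tangent C (cvec (hvec x))) S}"

definition punctured_conic :: "real^3^3 \<Rightarrow> real^3^3 \<Rightarrow> (real^2) set" where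
  "punctured_conic C S = affine_conic C - base_points C S"

text \<open>The complex projective line through \<open>q\<close> with direction \<open>v\<close>.\<close>

definition complex_line :: "real^2 \<Rightarrow> complex^2 \<Rightarrow> (complex^3) set" where
  "complex_line q v = vec.span {cvec (hvec q), dvec v}"

text \<open>
  The involution of the tangent space at \<open>q\<close> is a matrix \<open>J\<close>. Its eigenvalue-one space is
  exactly the tangent line of \<open>C\<close>, so the identity is excluded and the eigenvalue \<open>-1\<close> has a
  one-dimensional eigenspace. If \<open>q\<close> lies on \<open>S\<close>, there is a single tangent line to \<open>S\<close>
  through \<open>q\<close>, which the complexified involution then fixes.
\<close>

definition billiard_involution ::
    "real^3^3 \<Rightarrow> real^3^3 \<Rightarrow> real^2 \<Rightarrow> real^2^2 \<Rightarrow> bool" where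
  "billiard_involution C S q J \<longleftrightarrow>
     J ** J = mat 1 \<and>
     {v. J *v v = v} = tangent_direction C q \<and>
     (\<forall>v. v \<noteq> 0 \<longrightarrow>
        (is_tangent_to (complex_line q v) S \<longleftrightarrow> is_tangent_to (complex_line q (cmat J *v v)) S))"

definition dual_pencil_billiard ::
    "real^3^3 \<Rightarrow> real^3^3 \<Rightarrow> (real^2 \<Rightarrow> (real^2) set) \<Rightarrow> bool" where
  "dual_pencil_billiard C S N \<longleftrightarrow>
     (\<forall>q\<in>punctured_conic C S. \<exists>J. billiard_involution C S q J \<and>
        N q = {q + v | v. J *v v = - v})"

text \<open>Dual conic under the orthogonal polarity.\<close>

definition dual_conic :: "real^3^3 \<Rightarrow> (complex^3) set" where
  "dual_conic M = {m. m \<noteq> 0 \<and> is_tangent_to {w. cdot m w = 0} M}"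

text \<open>The second set is the conic with parameter \<open>\<lambda> = \<infinity>\<close>.\<close>

definition dual_pencil :: "real^3^3 \<Rightarrow> real^3^3 \<Rightarrow> (complex^3) set set" where
  "dual_pencil U A =
     {complex_conic (matrix_inv (cmat U - (\<chi> i j. l * cmat A $ i $ j))) | l.
        invertible (cmat U - (\<chi> i j. l * cmat A $ i $ j))}
     \<union> {W. invertible (cmat A) \<and> W = complex_conic (matrix_inv (cmat A))}"


section \<open>Orthogonality with respect to a quadratic form\<close>

definition lines_through :: "real^2 \<Rightarrow> (real^2) set set" where
  "lines_through x = {L. \<exists>v. v \<noteq> 0 \<and> L = {x + t *\<^sub>R v | t. True}}"

definition plane_over :: "(real^2) set \<Rightarrow> (real^3) set" where
  "plane_over L = span (hvec ` L)"

definition form_orthogonal ::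
    "real^3^3 \<Rightarrow> (real^3) set \<Rightarrow> (real^3) set \<Rightarrow> bool" where
  "form_orthogonal M H K \<longleftrightarrow> {v. \<forall>w\<in>H. (M *v v) \<bullet> w = 0} \<subseteq> K"

definition transversal_line_field ::
    "real^3^3 \<Rightarrow> (real^2) set \<Rightarrow> (real^2 \<Rightarrow> (real^2) set) \<Rightarrow> bool" where
  "transversal_line_field C X N \<longleftrightarrow>
     (\<forall>x\<in>X. N x \<in> lines_through x \<and> N x \<noteq> affine_tangent C x)"

text \<open>The orthogonality condition has to determine \<open>N x\<close> among all lines through \<open>x\<close>.\<close>

definition field_defined_by ::
    "real^3^3 \<Rightarrow> (real^2) set \<Rightarrow> real^3^3 \<Rightarrow> (real^2 \<Rightarrow> (real^2) set) \<Rightarrow> bool" where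
  "field_defined_by C X M N \<longleftrightarrow>
     transversal_line_field C X N \<and>
     (\<forall>x\<in>X. \<forall>L\<in>lines_through x.
        L = N x \<longleftrightarrow> form_orthogonal M (plane_over (affine_tangent C x)) (plane_over L))"


section \<open>Billiards on surfaces of constant curvature\<close>

definition open_arc_of :: "'a::topological_space set \<Rightarrow> 'a set \<Rightarrow> bool" where
  "open_arc_of X I \<longleftrightarrow> openin (top_of_set X) I \<and> I homeomorphic {0<..<1::real}"

definition finite_union_of_arcs :: "'a::topological_space set \<Rightarrow> 'a set \<Rightarrow> bool" where
  "finite_union_of_arcs X Y \<longleftrightarrow>
     (\<exists>\<I>. finite \<I> \<and> (\<forall>I\<in>\<I>. open_arc_of X I) \<and> Y = \<Union>\<I>)"

text \<open>Embedded one-dimensional submanifolds of class \<open>C\<^sup>1\<close>, not necessarily connected.\<close>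

definition regular_curve :: "'a::euclidean_space set \<Rightarrow> bool" where
  "regular_curve \<Gamma> \<longleftrightarrow>
     (\<forall>y\<in>\<Gamma>. \<exists>V \<gamma> \<delta>. y \<in> V \<and> openin (top_of_set \<Gamma>) V \<and>
        homeomorphism {0<..<1::real} V \<gamma> \<delta> \<and>
        \<gamma> C1_differentiable_on {0<..<1} \<and>
        (\<forall>t\<in>{0<..<1}. vector_derivative \<gamma> (at t) \<noteq> 0))"

text \<open>
  The tangent space of a submanifold, as the set of velocities at \<open>y\<close> of paths in it.
\<close>

definition tangent_space :: "'a::real_normed_vector set \<Rightarrow> 'a \<Rightarrow> 'a set" where
  "tangent_space X y =
     {v. \<exists>\<gamma>::real \<Rightarrow> 'a. \<gamma> 0 = y \<and> (\<forall>\<^sub>F t in at 0. \<gamma> t \<in> X) \<and>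
           (\<gamma> has_vector_derivative v) (at 0)}"

text \<open>
  The second argument is the bilinear form on \<^typ>\<open>real^3\<close> whose restriction to the tangent
  planes is the metric of the surface.
\<close>

definition constant_curvature_surface ::
    "(real^3) set \<Rightarrow> (real^3 \<Rightarrow> real^3 \<Rightarrow> real) \<Rightarrow> bool" where
  "constant_curvature_surface \<Sigma> g \<longleftrightarrow>
     \<Sigma> = {x. x$3 = 1} \<and> g = (\<lambda>u v. u$1 * v$1 + u$2 * v$2) \<or>
     \<Sigma> = {x. (x$1)^2 + (x$2)^2 + (x$3)^2 = 1} \<and>
       g = (\<lambda>u v. u$1 * v$1 + u$2 * v$2 + u$3 * v$3) \<or>
     \<Sigma> = {x. (x$3)^2 - (x$1)^2 - (x$2)^2 = 1 \<and> x$3 > 0} \<and>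
       g = (\<lambda>u v. u$1 * v$1 + u$2 * v$2 - u$3 * v$3)"

definition normal_line ::
    "(real^3) set \<Rightarrow> (real^3 \<Rightarrow> real^3 \<Rightarrow> real) \<Rightarrow> (real^3) set \<Rightarrow> real^3 \<Rightarrow> (real^3) set" where
  "normal_line \<Sigma> g \<Gamma> y = {n \<in> tangent_space \<Sigma> y. \<forall>v\<in>tangent_space \<Gamma> y. g n v = 0}"

text \<open>
  Points of the real projective plane are one-dimensional subspaces of \<^typ>\<open>real^3\<close>, and \<open>proj\<close>
  is the tautological projection. An invertible matrix acts on subspaces by taking images.
\<close>

definition proj :: "real^3 \<Rightarrow> (real^3) set" where
  "proj v = span {v}"

definition projective_map :: "real^3^3 \<Rightarrow> (real^3) set \<Rightarrow> (real^3) set" where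
  "projective_map P W = (*v) P ` W"

text \<open>
  A line in the tangent space of the projective plane at \<open>proj y\<close> is represented by the
  projective line (a two-dimensional subspace containing \<open>y\<close>) having this tangent line. The
  kernel of the differential of \<open>proj\<close> at \<open>y\<close> is spanned by \<open>y\<close>; therefore the differential
  sends a line \<open>n\<close> transversal to \<open>y\<close> to the plane spanned by \<open>y\<close> and \<open>n\<close>.
\<close>

definition dproj :: "real^3 \<Rightarrow> (real^3) set \<Rightarrow> (real^3) set" where
  "dproj y n = span (insert y n)"

text \<open>
  \<open>\<Gamma>\<close> is a curve in \<open>\<Sigma>\<close> whose billiard projects to the image under \<open>P\<close> of the billiard on \<open>X\<close>
  with the line field \<open>N\<close>.
\<close>

definition projection_of_billiard ::
    "(real^3) set \<Rightarrow> (real^3 \<Rightarrow> real^3 \<Rightarrow> real) \<Rightarrow> (real^3) set \<Rightarrow> real^3^3 \<Rightarrow>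
     (real^2) set \<Rightarrow> (real^2 \<Rightarrow> (real^2) set) \<Rightarrow> bool" where
  "projection_of_billiard \<Sigma> g \<Gamma> P X N \<longleftrightarrow>
     \<Gamma> \<subseteq> \<Sigma> \<and> regular_curve \<Gamma> \<and>
     bij_betw proj \<Gamma> ((\<lambda>x. projective_map P (proj (hvec x))) ` X) \<and>
     (\<forall>x\<in>X. \<forall>y\<in>\<Gamma>. proj y = projective_map P (proj (hvec x)) \<longrightarrow>
        dproj y (normal_line \<Sigma> g \<Gamma> y) = projective_map P (plane_over (N x)))"

end

theory Submission
  imports Defs
begin

text \<open>
  At a point \<open>x\<close> of \<open>C\<close> the eigenline of the reflection for \<open>-1\<close> joins \<open>x\<close> to the pole
  \<open>S\<^sup>-\<^sup>1 C x\<close> of the tangent line with respect to \<open>S\<close>: in coordinates along the two eigenlines, the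
  quadratic form whose zeros are the tangents to \<open>S\<close> has zero set symmetric under \<open>z \<mapsto> -z\<close>. For \<open>M\<close> in
  the dual pencil, \<open>M\<^sup>-\<^sup>1\<close> is a combination of \<open>C\<^sup>-\<^sup>1\<close> and \<open>S\<^sup>-\<^sup>1\<close>, so the \<open>M\<close>-pole
  \<open>M\<^sup>-\<^sup>1 C x\<close> of the tangent lies on the same line.

  The third statement always has a hyperbolic solution. If \<open>M\<^sup>-\<^sup>1\<close> is a small perturbation of
  \<open>C\<^sup>-\<^sup>1\<close> in the pencil, then \<open>M\<close> has Lorentz signature like \<open>C\<close>, and the sign of the
  perturbation can be chosen so that \<open>M\<close> is negative at a given point of \<open>C\<close> that is not a base point.
  Hence a nearby arc of \<open>C\<close> lies inside the Klein disk of \<open>M\<close>, where \<open>M\<close>-orthogonality is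
  orthogonality in the hyperbolic plane.
\<close>

section \<open>Bilinear algebra in dimension three\<close>

text \<open>The data are given by complex zero sets, and a conic fixes its matrix only up to a
  scalar that is complex a priori. So a small Nullstellensatz comes before any formula for the
  pencil: a symmetric matrix with the same zeros as a regular one is a multiple of it. The parameter
  of the pencil may be complex too; real coefficients are recovered by taking real parts.

  The computations run between points and covectors. For \<open>x\<close> on \<open>C\<close>, the
  covector \<open>l = C x\<close> is the tangent and \<open>n = S^-1 l\<close> its pole. The number
  \<open><n, l>\<close> vanishes exactly at base points. Where it is nonzero, the pole is off the
  tangent, so the normal is transversal; and for \<open>M = (C^-1 + \<epsilon> S^-1)^-1\<close> the
  value \<open><M x, x>\<close> is \<open>- \<epsilon> <n, l>\<close> to first order, which is why
  one sign of \<epsilon> always puts \<open>x\<close> inside the disk.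

  \<open>vdot\<close> is defined over any commutative ring so that real and complex arguments share
  their lemmas.\<close>

definition vdot :: "'a::comm_ring_1^'n \<Rightarrow> 'a^'n \<Rightarrow> 'a" where
  "vdot v w = (\<Sum>i\<in>UNIV. v$i * w$i)"

text \<open>Read projectively: the join of two points and, dually, the meet of two lines given by
  covectors.\<close>

definition xprod :: "'a::comm_ring_1^3 \<Rightarrow> 'a^3 \<Rightarrow> 'a^3" where
  "xprod v w = vector [v$2 * w$3 - v$3 * w$2, v$3 * w$1 - v$1 * w$3, v$1 * w$2 - v$2 * w$1]"

lemma cdot_eq_vdot: "cdot v w = vdot v w"
  by (simp add: cdot_def vdot_def)

lemma inner_eq_vdot: "v \<bullet> w = vdot v (w :: real^'n)"
  by (simp add: inner_vec_def vdot_def)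

lemma vdot_simps [simp]:
  "vdot (u + v) w = vdot u w + vdot v w"
  "vdot u (v + w) = vdot u v + vdot u w"
  "vdot (u - v) w = vdot u w - vdot v w"
  "vdot u (v - w) = vdot u v - vdot u w"
  "vdot (- u) v = - vdot u v"
  "vdot u (- v) = - vdot u v"
  "vdot (c *s u) v = c * vdot u v"
  "vdot u (c *s v) = c * vdot u v"
  "vdot 0 v = 0"
  "vdot u 0 = 0"
  by (simp_all add: vdot_def algebra_simps sum.distrib sum_subtractf sum_distrib_left sum_negf)

lemma vdot_commute: "vdot u v = vdot v u"
  by (simp add: vdot_def mult.commute)

lemma vdot_3: "vdot u v = u$1 * v$1 + u$2 * v$2 + u$3 * v$3" for u v :: "'a::comm_ring_1^3"
  by (simp add: vdot_def sum_3)

lemma vdot_axis: "vdot u (axis i 1) = u $ i"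
  by (simp add: vdot_def axis_def if_distrib cong: if_cong)

lemma vdot_all_eq_0: "(\<And>w. vdot u w = 0) \<Longrightarrow> u = 0"
  by (metis vdot_axis vec_eq_iff zero_index)

lemma vec3_eq_iff: "u = v \<longleftrightarrow> u$1 = v$1 \<and> u$2 = v$2 \<and> u$3 = v$3" for u v :: "'a^3"
  by (simp add: vec_eq_iff forall_3)

lemma vec2_eq_iff: "u = v \<longleftrightarrow> u$1 = v$1 \<and> u$2 = v$2" for u v :: "'a^2"
  by (simp add: vec_eq_iff forall_2)

lemma matrix_vector_mult_3:
  "(M *v v) = vector [vdot (M$1) v, vdot (M$2) v, vdot (M$3) v]" for M :: "'a::comm_ring_1^3^3"
  by (simp add: vec3_eq_iff matrix_vector_mult_def vdot_def)

lemma transpose_vdot: "vdot (M *v v) w = vdot v (transpose M *v w)"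
  for M :: "'a::comm_ring_1^'n^'m"
proof -
  have "vdot (M *v v) w = (\<Sum>i\<in>UNIV. \<Sum>j\<in>UNIV. M$i$j * v$j * w$i)"
    by (simp add: vdot_def matrix_vector_mult_def sum_distrib_right)
  also have "\<dots> = (\<Sum>j\<in>UNIV. \<Sum>i\<in>UNIV. M$i$j * v$j * w$i)"
    by (rule sum.swap)
  also have "\<dots> = vdot v (transpose M *v w)"
    by (simp add: vdot_def matrix_vector_mult_def transpose_def sum_distrib_left mult_ac)
  finally show ?thesis .
qed

lemma symmetric_vdot: "symmetric_matrix M \<Longrightarrow> vdot (M *v v) w = vdot (M *v w) v"
  for M :: "'a::comm_ring_1^'n^'n"
  by (metis symmetric_matrix_def transpose_vdot vdot_commute)

lemma matrix_vector_mult_minus: "A *v (- v) = - (A *v v)" for A :: "'a::comm_ring_1^'n^'m"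
  by (simp add: vec_eq_iff matrix_vector_mult_def sum_negf)

lemmas mv_simps = matrix_vector_right_distrib matrix_vector_mult_diff_distrib
  vector_scalar_commute matrix_vector_mult_minus

lemma matrix_eqI_vector: "(\<And>v. A *v v = B *v v) \<Longrightarrow> A = B" for A B :: "'a::comm_ring_1^'n^'m"
  by (metis matrix_eq)

lemma invertible_matrix_inv:
  assumes "invertible A"
  shows "A ** matrix_inv A = mat 1" "matrix_inv A ** A = mat 1"
  using someI_ex[OF assms[unfolded invertible_def]] by (auto simp: matrix_inv_def)

lemma matrix_inv_eqI: "A ** B = mat 1 \<Longrightarrow> B ** A = mat 1 \<Longrightarrow> matrix_inv A = B"
  by (metis invertible_def invertible_matrix_inv(1) matrix_mul_assoc matrix_mul_lid matrix_mul_rid)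

lemma matrix_inv_cancel [simp]:
  fixes A :: "'a::comm_ring_1^'n^'n"
  assumes "invertible A"
  shows "A *v (matrix_inv A *v v) = v" "matrix_inv A *v (A *v v) = v"
  using invertible_matrix_inv[OF assms] by (simp_all add: matrix_vector_mul_assoc)

lemma invertible_inv: "invertible A \<Longrightarrow> invertible (matrix_inv A)"
  using invertible_matrix_inv invertible_def by blast

lemma matrix_inv_inv: "invertible A \<Longrightarrow> matrix_inv (matrix_inv A) = A"
  by (simp add: invertible_matrix_inv matrix_inv_eqI)

lemma invertible_mult_eq_0: "invertible A \<Longrightarrow> A *v v = 0 \<Longrightarrow> v = 0"
  for A :: "'a::comm_ring_1^'n^'n"
  by (metis matrix_inv_cancel(2) matrix_vector_mult_0_right)

lemma symmetric_matrix_inv: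
  fixes A :: "'a::comm_ring_1^'n^'n"
  assumes "symmetric_matrix A" "invertible A"
  shows "symmetric_matrix (matrix_inv A)"
  unfolding symmetric_matrix_def
proof (rule sym, rule matrix_inv_eqI)
  have "transpose (matrix_inv A ** A) = mat 1" "transpose (A ** matrix_inv A) = mat 1"
    by (simp_all add: assms(2) invertible_matrix_inv transpose_mat)
  then show "A ** transpose (matrix_inv A) = mat 1" "transpose (matrix_inv A) ** A = mat 1"
    using assms(1) by (simp_all add: matrix_transpose_mul symmetric_matrix_def)
qed

section \<open>Joins, meets and incidence in the projective plane\<close>

lemma xprod_orth [simp]: "vdot (xprod v w) v = 0" "vdot (xprod v w) w = 0"
  by (simp_all add: vdot_3 xprod_def algebra_simps)

lemma xprod_eq_0D:
  fixes x y :: "'a::field^3"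
  assumes "xprod x y = 0" "y \<noteq> 0"
  obtains k where "x = k *s y"
proof -
  obtain i where i: "y $ i \<noteq> 0" using assms(2) by (auto simp: vec_eq_iff)
  have eq: "x$2 * y$3 = x$3 * y$2" "x$3 * y$1 = x$1 * y$3" "x$1 * y$2 = x$2 * y$1"
    using assms(1) by (simp_all add: xprod_def vec3_eq_iff)
  have "x = (x$i / y$i) *s y"
    using exhaust_3[of i] i eq by (auto simp: vec3_eq_iff field_simps)
  then show thesis by (rule that)
qed

text \<open>Two distinct lines \<open>a\<close>, \<open>b\<close> meet in one point. By the triple
  product expansion, anything orthogonal to both has zero \<open>xprod\<close> with
  \<open>xprod a b\<close>, so \<open>u\<close> and \<open>v\<close> are multiples of that
  vector.\<close>

lemma orthogonal_to_two_multiple: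
  fixes a b u v :: "'a::field^3"
  assumes ab: "xprod a b \<noteq> 0"
    and u: "vdot a u = 0" "vdot b u = 0" "u \<noteq> 0"
    and v: "vdot a v = 0" "vdot b v = 0"
  obtains k where "v = k *s u"
proof -
  have *: "xprod w (xprod a b) = 0" if "vdot a w = 0" "vdot b w = 0" for w
  proof -
    have "xprod w (xprod a b) = vdot b w *s a - vdot a w *s b"
      by (simp add: vec3_eq_iff xprod_def vdot_3 algebra_simps)
    then show ?thesis using that by simp
  qed
  obtain k where k: "u = k *s xprod a b" using xprod_eq_0D[OF *[OF u(1,2)] ab] .
  obtain l where l: "v = l *s xprod a b" using xprod_eq_0D[OF *[OF v] ab] .
  have "k \<noteq> 0" using k u(3) by auto
  then have "v = (l / k) *s u" by (simp add: k l vector_smult_assoc)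
  then show thesis by (rule that)
qed

text \<open>A line determines its covector up to scale: every \<open>xprod m w\<close> lies in the
  kernel of \<open>m\<close>, so the triple product of \<open>l\<close>, \<open>m\<close>,
  \<open>w\<close> vanishes for all \<open>w\<close>.\<close>

lemma kernel_subset_imp_multiple:
  fixes m l :: "'a::field^3"
  assumes "{w. vdot m w = 0} \<subseteq> {w. vdot l w = 0}" "m \<noteq> 0"
  obtains k where "l = k *s m"
proof -
  have "vdot (xprod l m) w = 0" for w
  proof -
    have "vdot (xprod l m) w = vdot l (xprod m w)"
      by (simp add: vdot_3 xprod_def algebra_simps)
    also have "\<dots> = 0"
      using assms(1) xprod_orth(1)[of m w] vdot_commute[of m] by (metis (mono_tags) mem_Collect_eq subsetD)
    finally show ?thesis .
  qed
  then have "xprod l m = 0" by (rule vdot_all_eq_0)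
  then show thesis using xprod_eq_0D assms(2) that by blast
qed

section \<open>Frames adapted to a conic\<close>

text \<open>
  In the basis \<open>p, e, f\<close> the quadratic form of \<open>C\<close> at \<open>x p + y e + z f\<close> is \<open>2 a (x z - y\<^sup>2)\<close>,
  so the conic is parametrized by \<open>p + t e + t\<^sup>2 f\<close>.
\<close>

definition conic_frame :: "'a::field^3^3 \<Rightarrow> 'a^3 \<Rightarrow> 'a^3 \<Rightarrow> 'a^3 \<Rightarrow> 'a \<Rightarrow> bool" where
  "conic_frame C p e f a \<longleftrightarrow> symmetric_matrix C \<and> a \<noteq> 0 \<and>
     vdot (C *v p) p = 0 \<and> vdot (C *v p) e = 0 \<and> vdot (C *v p) f = a \<and>
     vdot (C *v e) e = - 2 * a \<and> vdot (C *v e) f = 0 \<and> vdot (C *v f) f = 0"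

definition frame_point :: "'a::field^3 \<Rightarrow> 'a^3 \<Rightarrow> 'a^3 \<Rightarrow> 'a \<Rightarrow> 'a^3" where
  "frame_point p e f t = p + t *s e + t\<^sup>2 *s f"

lemma conic_frameD:
  assumes "conic_frame C p e f a"
  shows "symmetric_matrix C" "a \<noteq> 0"
    "vdot (C *v p) p = 0" "vdot (C *v p) e = 0" "vdot (C *v p) f = a"
    "vdot (C *v e) p = 0" "vdot (C *v e) e = - 2 * a" "vdot (C *v e) f = 0"
    "vdot (C *v f) p = a" "vdot (C *v f) e = 0" "vdot (C *v f) f = 0"
  using assms unfolding conic_frame_def
  by (auto simp: symmetric_vdot[of C e p] symmetric_vdot[of C f p] symmetric_vdot[of C f e])

text \<open>The Gram matrix of the frame is antidiagonal, so each coordinate is read off by pairing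
  with the opposite vector. These pairings form a left inverse of the matrix with columns
  \<open>p\<close>, \<open>e\<close>, \<open>f\<close>; for square matrices this already gives the
  basis property.\<close>

lemma conic_frame_decomp:
  fixes C :: "'a::field_char_0^3^3"
  assumes "conic_frame C p e f a"
  shows "v = (vdot (C *v f) v / a) *s p + (vdot (C *v e) v / (- 2 * a)) *s e +
             (vdot (C *v p) v / a) *s f"
proof -
  note F = conic_frameD[OF assms]
  define B where "B = transpose (vector [p, e, f] :: 'a^3^3)"
  define A where "A = (vector [(1 / a) *s (C *v f), (1 / (- 2 * a)) *s (C *v e),
                               (1 / a) *s (C *v p)] :: 'a^3^3)"
  have B: "B *v w = w$1 *s p + w$2 *s e + w$3 *s f" for w
    by (simp add: B_def vec3_eq_iff matrix_vector_mult_def sum_3 transpose_def algebra_simps)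
  have A: "A *v w = vector [vdot (C *v f) w / a, vdot (C *v e) w / (- 2 * a), vdot (C *v p) w / a]"
    for w
    by (simp add: matrix_vector_mult_3 A_def)
  have "A *v (B *v w) = w" for w
    unfolding B A using F by (simp add: vec3_eq_iff)
  then have "A ** B = mat 1"
    by (intro matrix_eqI_vector) (simp flip: matrix_vector_mul_assoc)
  then have "B ** A = mat 1" by (simp add: matrix_left_right_inverse)
  then have "B *v (A *v v) = v" by (simp add: matrix_vector_mul_assoc)
  then show ?thesis unfolding A B by simp
qed

text \<open>Geometrically, \<open>f\<close> is a second point of the conic and \<open>e\<close> is
  the meet of the tangents at \<open>p\<close> and \<open>f\<close>.\<close>

lemma conic_frame_exists:
  fixes C :: "'a::field_char_0^3^3"
  assumes C: "symmetric_matrix C" "invertible C" and p: "p \<noteq> 0" "vdot (C *v p) p = 0"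
  obtains e f a where "conic_frame C p e f a"
proof -
  have Cp: "C *v p \<noteq> 0" using C(2) invertible_mult_eq_0 p(1) by blast
  then obtain w where w: "vdot (C *v p) w \<noteq> 0" using vdot_all_eq_0 by blast
  define c where "c = vdot (C *v p) w"
  \<comment> \<open>The multiple of \<open>p\<close> is chosen to make \<open>g\<close> isotropic:
    the second point of the conic on the line through \<open>p\<close> and \<open>w\<close>.\<close>
  define g where "g = w - (vdot (C *v w) w / (2 * c)) *s p"
  have c0: "c \<noteq> 0" using w by (simp add: c_def)
  have pg: "vdot (C *v p) g = c" by (simp add: g_def c_def p)
  have gg: "vdot (C *v g) g = 0"
    using c0 unfolding g_def
    by (simp add: matrix_vector_mult_diff_distrib vector_scalar_commute p
        symmetric_vdot[OF C(1), of w p] flip: c_def)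
  have gp: "vdot (C *v g) p = c" using pg symmetric_vdot[OF C(1)] by metis
  define e where "e = xprod (C *v p) (C *v g)"
  have e_nz: "e \<noteq> 0"
  proof
    assume "e = 0"
    moreover have "C *v g \<noteq> 0" using gp c0 by auto
    ultimately obtain k where "C *v p = k *s (C *v g)"
      unfolding e_def using xprod_eq_0D by blast
    then have "vdot (C *v p) g = 0" by (simp add: gg)
    then show False using pg c0 by simp
  qed
  have pe: "vdot (C *v p) e = 0" and ge: "vdot (C *v g) e = 0"
    unfolding e_def by (simp_all add: vdot_commute[of _ "xprod _ _"])
  have ep: "vdot (C *v e) p = 0" and eg: "vdot (C *v e) g = 0"
    using pe ge symmetric_vdot[OF C(1)] by metis+
  define b where "b = vdot (C *v e) e"
  have b: "b \<noteq> 0"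
  proof
    \<comment> \<open>Then \<open>e\<close> would be orthogonal to \<open>p\<close>,
      \<open>g\<close> and itself. Every \<open>v\<close> is a combination of these three, so
      \<open>e\<close> would lie in the kernel of \<open>C\<close>.\<close>
    assume b0: "b = 0"
    have "vdot (C *v e) v = 0" for v
    proof -
      define u where "u = v - (vdot (C *v g) v / c) *s p - (vdot (C *v p) v / c) *s g"
      have "vdot (C *v p) u = 0" "vdot (C *v g) u = 0"
        using c0 by (simp_all add: u_def p pg gp gg)
      moreover have "xprod (C *v p) (C *v g) \<noteq> 0" using e_nz by (simp add: e_def)
      ultimately obtain k where "u = k *s e" using orthogonal_to_two_multiple[of "C *v p" "C *v g" e u] pe ge e_nz by blast
      then have "vdot (C *v e) u = 0" using b0 by (simp add: b_def)
      then show ?thesis by (simp add: u_def ep eg)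
    qed
    then have "C *v e = 0" by (rule vdot_all_eq_0)
    then show False using C(2) invertible_mult_eq_0 e_nz by blast
  qed
  \<comment> \<open>Rescaling \<open>g\<close> by \<open>- b / (2 * c)\<close> gives
    \<open><C p, f> = - b / 2 = a\<close>, as \<open><C e, e> = b = - 2 * a\<close> demands.\<close>
  have "conic_frame C p e ((- b / (2 * c)) *s g) (- b / 2)"
    unfolding conic_frame_def using b c0
    by (simp add: C p pe pg eg gg mv_simps flip: b_def)
  then show thesis by (rule that)
qed

lemma frame_point_isotropic:
  fixes C :: "'a::field_char_0^3^3"
  assumes "conic_frame C p e f a"
  shows "vdot (C *v frame_point p e f t) (frame_point p e f t) = 0"
  using conic_frameD[OF assms]
  by (simp add: frame_point_def matrix_vector_right_distrib vector_scalar_commute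
      power2_eq_square algebra_simps)

lemma conic_frame_quadratic:
  fixes C :: "'a::field_char_0^3^3"
  assumes "conic_frame C p e f a"
  shows "vdot (C *v (x *s p + y *s e + z *s f)) (x *s p + y *s e + z *s f) =
     2 * a * (x * z - y\<^sup>2)"
  using conic_frameD[OF assms]
  by (simp add: matrix_vector_right_distrib vector_scalar_commute power2_eq_square algebra_simps)

text \<open>
  The hypotheses say that the quartic \<open>t \<mapsto> \<langle>Q \<phi>(t), \<phi>(t)\<rangle>\<close> along the parametrized conic vanishes.
\<close>

lemma quadratic_form_multiple:
  fixes C Q :: "'a::field_char_0^3^3"
  assumes fr: "conic_frame C p e f a" and Q: "symmetric_matrix Q"
    and z: "vdot (Q *v p) p = 0" "vdot (Q *v p) e = 0" "vdot (Q *v e) e + 2 * vdot (Q *v p) f = 0"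
      "vdot (Q *v e) f = 0" "vdot (Q *v f) f = 0"
  obtains k where "\<And>v. Q *v v = k *s (C *v v)"
proof -
  note F = conic_frameD[OF fr]
  define k where "k = vdot (Q *v p) f / a"
  have ak: "vdot (Q *v p) f = k * a" using F(2) by (simp add: k_def)
  have ee: "vdot (Q *v e) e = - 2 * (k * a)" using z(3) ak by (simp add: eq_neg_iff_add_eq_0)
  note sy = symmetric_vdot[OF Q, of e p] symmetric_vdot[OF Q, of f p] symmetric_vdot[OF Q, of f e]
  have "vdot (Q *v v) w = vdot (k *s (C *v v)) w" for v w
  proof -
    have "vdot (Q *v (x *s p + y *s e + z *s f)) (x' *s p + y' *s e + z' *s f)
        = vdot (k *s (C *v (x *s p + y *s e + z *s f))) (x' *s p + y' *s e + z' *s f)" for x y z x' y' z'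
      using F by (simp add: matrix_vector_right_distrib vector_scalar_commute z sy ak ee algebra_simps)
    then show ?thesis
      using conic_frame_decomp[OF fr, of v] conic_frame_decomp[OF fr, of w] by metis
  qed
  then have "vdot (Q *v v - k *s (C *v v)) w = 0" for v w by simp
  then have "Q *v v = k *s (C *v v)" for v using vdot_all_eq_0 by (metis eq_iff_diff_eq_0)
  then show thesis by (rule that)
qed

text \<open>Along the parametrization \<open>Q\<close> is a quartic in \<open>t\<close> whose end
  coefficients vanish because \<open>p\<close> and \<open>f\<close> lie on the conic. A few values
  of \<open>t\<close> kill the other three, which leaves the hypotheses of
  \<open>quadratic_form_multiple\<close>.\<close>

lemma quadric_contains_conic:
  fixes C Q :: "'a::field_char_0^3^3"
  assumes fr: "conic_frame C p e f a" and Q: "symmetric_matrix Q"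
    and sub: "\<And>v. v \<noteq> 0 \<Longrightarrow> vdot (C *v v) v = 0 \<Longrightarrow> vdot (Q *v v) v = 0"
  obtains k where "\<And>v. Q *v v = k *s (C *v v)"
proof -
  note F = conic_frameD[OF fr]
  have f: "vdot (Q *v f) f = 0" using sub[of f] F(11) by (cases "f = 0") auto
  have p: "vdot (Q *v p) p = 0" using sub[of p] F(3) by (cases "p = 0") auto
  note sy = symmetric_vdot[OF Q, of e p] symmetric_vdot[OF Q, of f p] symmetric_vdot[OF Q, of f e]
  have pt: "2 * t * vdot (Q *v p) e + t^2 * (vdot (Q *v e) e + 2 * vdot (Q *v p) f)
      + 2 * t^3 * vdot (Q *v e) f = 0" for t
  proof -
    let ?v = "frame_point p e f t"
    have "vdot (C *v f) ?v = a" by (simp add: frame_point_def F)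
    then have "?v \<noteq> 0" using F(2) by auto
    then have "vdot (Q *v ?v) ?v = 0" using sub frame_point_isotropic[OF fr] by blast
    then show ?thesis
      by (simp add: frame_point_def matrix_vector_right_distrib vector_scalar_commute sy p f
          algebra_simps power2_eq_square power3_eq_cube)
  qed
  define A B D where "A = vdot (Q *v p) e" and "B = vdot (Q *v e) e + 2 * vdot (Q *v p) f"
    and "D = vdot (Q *v e) f"
  \<comment> \<open>The parameters 1, -1, 2 separate the three coefficients up to the factors 2 and
    12, which are invertible in characteristic zero.\<close>
  have 1: "2 * A + B + 2 * D = 0" using pt[of 1] by (simp add: A_def B_def D_def)
  have 2: "- 2 * A + B - 2 * D = 0" using pt[of "-1"] by (simp add: A_def B_def D_def)
  have 3: "4 * A + 4 * B + 16 * D = 0" using pt[of 2] by (simp add: A_def B_def D_def)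
  have "2 * B = 0" using 1 2 by algebra
  then have B: "B = 0" by simp
  have "12 * D = 0" using 1 3 B by algebra
  then have D: "D = 0" by simp
  have "2 * A = 0" using 1 B D by simp
  then have A: "A = 0" by simp
  show thesis
    using quadratic_form_multiple[OF fr Q p _ _ _ f] A B D that unfolding A_def B_def D_def by blast
qed

section \<open>Complexification and dual conics\<close>

lemma cvec_component [simp]: "cvec v $ i = of_real (v $ i)"
  by (simp add: cvec_def)

lemma cmat_component [simp]: "cmat M $ i $ j = of_real (M $ i $ j)"
  by (simp add: cmat_def)

lemma cmat_mult_cvec [simp]: "cmat M *v cvec v = cvec (M *v v)"
  by (simp add: vec_eq_iff matrix_vector_mult_def)

lemma vdot_cvec [simp]: "vdot (cvec u) (cvec v) = of_real (vdot u v)"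
  by (simp add: vdot_def)

lemma cvec_eq_0 [simp]: "cvec v = 0 \<longleftrightarrow> v = 0"
  by (simp add: vec_eq_iff)

lemma cmat_mult: "cmat (A ** B) = cmat A ** cmat B"
  by (simp add: vec_eq_iff matrix_matrix_mult_def)

lemma cmat_mat_1 [simp]: "cmat (mat 1) = mat 1"
  by (simp add: vec_eq_iff mat_def)

lemma symmetric_cmat: "symmetric_matrix M \<Longrightarrow> symmetric_matrix (cmat M)"
  by (simp add: symmetric_matrix_def vec_eq_iff transpose_def)

lemma invertible_cmat_inv:
  assumes "invertible A"
  shows "invertible (cmat A)" "matrix_inv (cmat A) = cmat (matrix_inv A)"
proof -
  have "cmat A ** cmat (matrix_inv A) = mat 1" "cmat (matrix_inv A) ** cmat A = mat 1"
    using invertible_matrix_inv[OF assms] by (simp_all flip: cmat_mult)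
  then show "invertible (cmat A)" "matrix_inv (cmat A) = cmat (matrix_inv A)"
    by (auto simp: invertible_def intro: matrix_inv_eqI)
qed

lemma invertible_cmat_iff: "invertible (cmat A) \<longleftrightarrow> invertible A" for A :: "real^3^3"
proof -
  have "det (cmat A) = of_real (det A)" by (simp add: det_3)
  then show ?thesis by (simp add: invertible_det_nz)
qed

text \<open>Over the complex numbers every conic meets the line \<open>x3 = 0\<close>, either at
  \<open>[1:0:0]\<close> or at a root \<open>[x:1:0]\<close> of a quadratic; \<open>b\<close> is the
  full mixed coefficient of a possibly asymmetric \<open>K\<close>.\<close>

lemma complex_isotropic_vector:
  obtains p :: "complex^3" where "p \<noteq> 0" "vdot (K *v p) p = 0"
proof (cases "K$1$1 = 0")
  case True
  then show thesis
    by (intro that[of "vector [1, 0, 0]"]) (simp_all add: matrix_vector_mult_3 vdot_3 vec3_eq_iff)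
next
  case False
  define b where "b = K$1$2 + K$2$1"
  define x where "x = (- b + csqrt (b\<^sup>2 - 4 * K$1$1 * K$2$2)) / (2 * K$1$1)"
  have "(2 * K$1$1 * x + b)\<^sup>2 = b\<^sup>2 - 4 * K$1$1 * K$2$2"
    using False by (simp add: x_def)
  then have "4 * K$1$1 * (K$1$1 * x\<^sup>2 + b * x + K$2$2) = 0"
    by (simp add: power2_eq_square algebra_simps)
  then have "K$1$1 * x\<^sup>2 + b * x + K$2$2 = 0" using False by simp
  then show thesis
    by (intro that[of "vector [x, 1, 0]"])
      (simp_all add: matrix_vector_mult_3 vdot_3 vec3_eq_iff b_def power2_eq_square algebra_simps)
qed

section \<open>Complex conics and their matrices\<close>

lemma complex_conic_vdot: "complex_conic M = {v. v \<noteq> 0 \<and> vdot (M *v v) v = 0}"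
  by (simp add: complex_conic_def cdot_eq_vdot)

text \<open>A regular complex conic has a point, hence a frame, and
  \<open>quadric_contains_conic\<close> applies. It remains to exclude the factor zero.\<close>

lemma complex_conic_eqD:
  assumes K: "symmetric_matrix K" "invertible K" and M: "symmetric_matrix M"
    and eq: "complex_conic M = complex_conic K"
  obtains k where "k \<noteq> 0" "\<And>v. M *v v = k *s (K *v v)"
proof -
  obtain p where p: "p \<noteq> 0" "vdot (K *v p) p = 0" by (rule complex_isotropic_vector)
  obtain e f a where fr: "conic_frame K p e f a" using conic_frame_exists[OF K p] .
  note F = conic_frameD[OF fr]
  obtain k where k: "\<And>v. M *v v = k *s (K *v v)"
    using quadric_contains_conic[OF fr M] eq unfolding complex_conic_vdot by blast
  \<comment> \<open>\<open>p + f\<close> lies off the conic of \<open>K\<close>, whereas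
    \<open>k = 0\<close> would make every nonzero vector a zero of \<open>M\<close>.\<close>
  have "vdot (K *v (p + f)) (p + f) = 2 * a" using F by (simp add: mv_simps)
  then have "p + f \<notin> complex_conic K" "p + f \<noteq> 0" using F(2) by (auto simp: complex_conic_vdot)
  moreover have "p + f \<in> complex_conic M" if "k = 0"
    using that \<open>p + f \<noteq> 0\<close> by (simp add: complex_conic_vdot k)
  ultimately have "k \<noteq> 0" using eq by blast
  then show thesis using k that by blast
qed

lemma complex_conic_multiple:
  assumes "\<And>v. M *v v = k *s (K *v v)" "k \<noteq> 0"
  shows "complex_conic M = complex_conic K"
  by (simp add: complex_conic_vdot assms)

lemma matrix_inv_multiple:
  fixes K M :: "'a::field^'n^'n"
  assumes M: "\<And>v. M *v v = k *s (K *v v)" and k: "k \<noteq> 0" and K: "invertible K"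
  shows "invertible M" "matrix_inv M *v v = (1 / k) *s (matrix_inv K *v v)"
proof -
  define B where "B = (\<chi> i j. matrix_inv K $ i $ j / k)"
  have B: "B *v v = (1 / k) *s (matrix_inv K *v v)" for v
    by (simp add: B_def vec_eq_iff matrix_vector_mult_def sum_distrib_left)
  have "M ** B = mat 1" "B ** M = mat 1"
    using k by (intro matrix_eqI_vector; simp add: M B K mv_simps flip: matrix_vector_mul_assoc)+
  then show "invertible M" "matrix_inv M *v v = (1 / k) *s (matrix_inv K *v v)"
    using B by (auto simp: invertible_def matrix_inv_eqI)
qed

section \<open>Tangency and dual conics\<close>

lemma regular_conic_matrixD:
  assumes "regular_conic_matrix C"
  shows "symmetric_matrix C" "invertible C" "symmetric_matrix (matrix_inv C)" "invertible (matrix_inv C)"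
  using assms by (auto simp: regular_conic_matrix_def symmetric_matrix_inv invertible_inv)

text \<open>The point of contact can only be the pole \<open>matrix_inv S *v m\<close>, and this
  point lies on \<open>S\<close> exactly if the covector \<open>m\<close> lies on the dual
  conic.\<close>

lemma is_tangent_to_iff:
  assumes S: "regular_conic_matrix S" and m: "m \<noteq> 0"
  shows "is_tangent_to {w. vdot m w = 0} S \<longleftrightarrow> vdot (cmat (matrix_inv S) *v m) m = 0"
proof -
  note S' = regular_conic_matrixD[OF S]
  have inv: "cmat S *v (cmat (matrix_inv S) *v v) = v" "cmat (matrix_inv S) *v (cmat S *v v) = v" for v
    using matrix_inv_cancel[OF invertible_cmat_inv(1)[OF S'(2)]] invertible_cmat_inv(2)[OF S'(2)]
    by simp_all
  show ?thesis
  proof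
    assume "is_tangent_to {w. vdot m w = 0} S"
    then obtain y where y: "y \<noteq> 0" "vdot (cmat S *v y) y = 0"
      and eq: "{w. vdot m w = 0} = {w. vdot (cmat S *v y) w = 0}"
      by (auto simp: is_tangent_to_def complex_tangent_def complex_conic_vdot cdot_eq_vdot)
    obtain k where k: "cmat S *v y = k *s m"
      using kernel_subset_imp_multiple[OF equalityD1[OF eq] m] .
    have yk: "y = k *s (cmat (matrix_inv S) *v m)"
      using inv(2)[of y] k by (simp add: mv_simps)
    then have "k \<noteq> 0" using y(1) by auto
    moreover have "k * (k * vdot m (cmat (matrix_inv S) *v m)) = 0"
      using y(2) unfolding k by (subst (asm) yk) (simp add: mv_simps)
    ultimately show "vdot (cmat (matrix_inv S) *v m) m = 0" by (simp add: vdot_commute)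
  next
    assume "vdot (cmat (matrix_inv S) *v m) m = 0"
    moreover have "cmat (matrix_inv S) *v m \<noteq> 0" using m inv(1)[of m] by auto
    ultimately have "cmat (matrix_inv S) *v m \<in> complex_conic (cmat S)"
      by (simp add: complex_conic_vdot inv vdot_commute)
    then show "is_tangent_to {w. vdot m w = 0} S"
      unfolding is_tangent_to_def complex_tangent_def cdot_eq_vdot
      by (intro bexI[of _ "cmat (matrix_inv S) *v m"]) (simp_all only: inv)
  qed
qed

lemma dual_conic_eq:
  "regular_conic_matrix C \<Longrightarrow> dual_conic C = complex_conic (cmat (matrix_inv C))"
  by (auto simp: dual_conic_def complex_conic_vdot is_tangent_to_iff cdot_eq_vdot)

lemma real_multiple_of_complex:
  assumes k: "\<And>v. cmat X *v v = k *s (cmat Y *v v)"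
  shows "X *v v = Re k *s (Y *v v)"
proof -
  have "cvec (X *v v) = k *s cvec (Y *v v)" using k[of "cvec v"] by simp
  then have "Re (cvec (X *v v) $ i) = Re ((k *s cvec (Y *v v)) $ i)" for i by simp
  then show ?thesis by (simp add: vec_eq_iff)
qed

text \<open>Equality of zero sets gives a complex factor; both matrices are real, so its real part
  serves as well.\<close>

lemma dual_conic_matrix:
  assumes C: "regular_conic_matrix C" and U: "symmetric_matrix U"
    and eq: "dual_conic C = complex_conic (cmat U)"
  obtains u where "u \<noteq> 0" "\<And>v. U *v v = u *s (matrix_inv C *v v)"
proof -
  note C' = regular_conic_matrixD[OF C]
  have "complex_conic (cmat U) = complex_conic (cmat (matrix_inv C))"
    using eq dual_conic_eq[OF C] by simp
  then obtain k where k: "k \<noteq> 0" "\<And>v. cmat U *v v = k *s (cmat (matrix_inv C) *v v)"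
    using complex_conic_eqD C' U symmetric_cmat invertible_cmat_inv(1) by metis
  have re: "U *v v = Re k *s (matrix_inv C *v v)" for v
    using real_multiple_of_complex k(2) by blast
  have "Re k \<noteq> 0"
  proof
    assume "Re k = 0"
    then have U0: "U *v v = 0" for v by (simp add: re)
    \<comment> \<open>\<open>matrix_inv C\<close> sends \<open>C *v 1\<close> to the all-ones
      vector, where the relation with nonzero \<open>k\<close> contradicts the vanishing of
      \<open>U\<close>.\<close>
    show False
      using k(2)[of "cvec (C *v 1)"] k(1) by (simp add: U0 C'(2) vec_eq_iff)
  qed
  then show thesis using re that by blast
qed

text \<open>The pencil is linear in the inverses, so the inverse of \<open>M\<close> is proportional
  to a complex combination of \<open>U\<close> and \<open>A\<close>. Since \<open>M\<close> is real,
  taking real parts makes the coefficients real.\<close>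

lemma dual_pencil_inverse:
  fixes C S U A M :: "real^3^3"
  assumes C: "regular_conic_matrix C"
    and U: "symmetric_matrix U" "\<And>v. U *v v = u *s (matrix_inv C *v v)"
    and A: "symmetric_matrix A" "\<And>v. A *v v = a *s (matrix_inv S *v v)"
    and M: "symmetric_matrix M" "complex_conic (cmat M) \<in> dual_pencil U A"
      "complex_conic (cmat M) \<noteq> complex_conic (cmat C)"
  obtains \<alpha> \<beta> where "invertible M" "\<beta> \<noteq> 0"
    "\<And>v. matrix_inv M *v v = \<alpha> *s (matrix_inv C *v v) + \<beta> *s (matrix_inv S *v v)"
proof -
  note C' = regular_conic_matrixD[OF C]
  have sym: "symmetric_matrix (\<chi> i j. x * cmat U $ i $ j + y * cmat A $ i $ j)" for x y
    using U(1) A(1) by (simp add: symmetric_matrix_def vec_eq_iff transpose_def)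
  \<comment> \<open>Homogeneous parameters treat both kinds of members alike: \<open>(1, -l)\<close>
    for finite \<open>l\<close> and \<open>(0, 1)\<close> for infinity.\<close>
  obtain x y where xy: "invertible (\<chi> i j. x * cmat U $ i $ j + y * cmat A $ i $ j)"
    and eq: "complex_conic (cmat M)
      = complex_conic (matrix_inv (\<chi> i j. x * cmat U $ i $ j + y * cmat A $ i $ j))"
  proof -
    from M(2) consider l where "invertible (cmat U - (\<chi> i j. l * cmat A $ i $ j))"
      "complex_conic (cmat M) = complex_conic (matrix_inv (cmat U - (\<chi> i j. l * cmat A $ i $ j)))"
      | "invertible (cmat A)" "complex_conic (cmat M) = complex_conic (matrix_inv (cmat A))"
      by (auto simp: dual_pencil_def)
    then show thesis
    proof cases
      case 1
      have "cmat U - (\<chi> i j. l * cmat A $ i $ j)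
          = (\<chi> i j. 1 * cmat U $ i $ j + (- l) * cmat A $ i $ j)"
        by (simp add: vec_eq_iff)
      then show thesis using 1 that[of 1 "- l"] by metis
    next
      case 2
      have "cmat A = (\<chi> i j. 0 * cmat U $ i $ j + 1 * cmat A $ i $ j)"
        by (simp add: vec_eq_iff)
      then show thesis using 2 that[of 0 1] by metis
    qed
  qed
  let ?K = "\<chi> i j. x * cmat U $ i $ j + y * cmat A $ i $ j"
  obtain k where k: "k \<noteq> 0" "\<And>v. cmat M *v v = k *s (matrix_inv ?K *v v)"
    using complex_conic_eqD[OF symmetric_matrix_inv[OF sym xy] invertible_inv[OF xy] symmetric_cmat[OF M(1)] eq] by blast
  note Kinv = matrix_inv_multiple[OF k(2,1) invertible_inv[OF xy], unfolded matrix_inv_inv[OF xy]]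
  have Mi: "invertible M" using Kinv(1) by (simp add: invertible_cmat_iff)
  have inv: "cmat (matrix_inv M) *v v = (1 / k) *s (?K *v v)" for v
    using Kinv(2) by (simp only: invertible_cmat_inv(2)[OF Mi])
  have K: "?K *v cvec v = x *s cvec (U *v v) + y *s cvec (A *v v)" for v
    by (simp add: vec_eq_iff matrix_vector_mult_def sum_distrib_left algebra_simps sum.distrib)
  define \<alpha> \<beta> where "\<alpha> = Re (x / k) * u" and "\<beta> = Re (y / k) * a"
  have ab: "matrix_inv M *v v = \<alpha> *s (matrix_inv C *v v) + \<beta> *s (matrix_inv S *v v)" for v
  proof -
    have "cvec (matrix_inv M *v v) = (x / k) *s cvec (U *v v) + (y / k) *s cvec (A *v v)"
      using inv[of "cvec v"] unfolding K by (simp add: vec_eq_iff field_simps)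
    then have "Re (cvec (matrix_inv M *v v) $ i)
      = Re (((x / k) *s cvec (U *v v) + (y / k) *s cvec (A *v v)) $ i)" for i by (rule arg_cong)
    then have "(matrix_inv M *v v) $ i = Re (x / k) * (U *v v) $ i + Re (y / k) * (A *v v) $ i" for i
      by (simp del: times_divide_eq_left times_divide_eq_right)
    then show ?thesis
      by (simp add: vec_eq_iff U(2) A(2) \<alpha>_def \<beta>_def
          del: times_divide_eq_left times_divide_eq_right)
  qed
  \<comment> \<open>With \<open>\<beta> = 0\<close>, inverting back makes \<open>C\<close> a nonzero
    multiple of \<open>M\<close>; both would define the same conic, which is excluded.\<close>
  have "\<beta> \<noteq> 0"
  proof
    assume "\<beta> = 0"
    then have *: "matrix_inv M *v v = \<alpha> *s (matrix_inv C *v v)" for v using ab by simp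
    have "C *v v = \<alpha> *s (M *v v)" for v
      using arg_cong[OF *[of "C *v v"], of "\<lambda>w. M *v w"] by (simp add: Mi C'(2) mv_simps)
    then have cc: "cmat C *v v = complex_of_real \<alpha> *s (cmat M *v v)" for v
    proof -
      have "C = (\<chi> i j. \<alpha> * M $ i $ j)"
      proof (rule matrix_eqI_vector)
        fix v
        have "\<alpha> *s (M *v v) = (\<chi> i j. \<alpha> * M $ i $ j) *v v"
          by (simp add: vec_eq_iff matrix_vector_mult_def sum_distrib_left mult.assoc)
        then show "C *v v = (\<chi> i j. \<alpha> * M $ i $ j) *v v"
          by (simp only: \<open>\<And>v. C *v v = \<alpha> *s (M *v v)\<close>)
      qed
      then have "C $ i $ j = (\<chi> i j. \<alpha> * M $ i $ j) $ i $ j" for i j by (rule arg_cong)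
      then have "C $ i $ j = \<alpha> * M $ i $ j" for i j by simp
      then show ?thesis
        by (simp add: vec_eq_iff matrix_vector_mult_def sum_distrib_left mult.assoc)
    qed
    have "\<alpha> \<noteq> 0"
    proof
      assume "\<alpha> = 0"
      then have "C *v 1 = 0" using \<open>\<And>v. C *v v = \<alpha> *s (M *v v)\<close> by simp
      then have "(1::real^3) = 0" using invertible_mult_eq_0[OF C'(2)] by blast
      then show False by simp
    qed
    then show False using complex_conic_multiple[OF cc] M(3) by simp
  qed
  then show thesis using Mi ab that by blast
qed

section \<open>The line field of a dual pencil type billiard\<close>

lemma hvec_component [simp]: "hvec x $ 1 = x $ 1" "hvec x $ 2 = x $ 2" "hvec x $ 3 = 1"
  by (simp_all add: hvec_def)

lemma dvec_component [simp]: "dvec x $ 1 = x $ 1" "dvec x $ 2 = x $ 2" "dvec x $ 3 = 0"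
  by (simp_all add: dvec_def)

lemma hvec_neq_0 [simp]: "hvec x \<noteq> 0"
  by (simp add: vec3_eq_iff)

lemma xprod_component [simp]:
  "xprod v w $ 1 = v$2 * w$3 - v$3 * w$2"
  "xprod v w $ 2 = v$3 * w$1 - v$1 * w$3"
  "xprod v w $ 3 = v$1 * w$2 - v$2 * w$1"
  by (simp_all add: xprod_def)

lemma xprod_hvec_dvec_neq_0:
  fixes x d :: "'a::field^3"
  assumes "x$3 = 1" "d$3 = 0" "d \<noteq> 0"
  shows "xprod x d \<noteq> 0"
  using assms by (auto simp: vec3_eq_iff)

lemma span_point_direction:
  fixes x d :: "'a::field^3"
  assumes x: "x$3 = 1" and d: "d$3 = 0" "d \<noteq> 0"
  shows "vec.span {x, d} = {w. vdot (xprod x d) w = 0}"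
proof (intro equalityI subsetI CollectI)
  fix w assume "w \<in> vec.span {x, d}"
  then obtain k l where "w - k *s x = l *s d"
    by (auto simp: vec.span_breakdown_eq vec.span_singleton)
  then have "w = l *s d + k *s x" by (metis diff_add_cancel)
  then show "vdot (xprod x d) w = 0" by simp
next
  fix w assume "w \<in> {w. vdot (xprod x d) w = 0}"
  then have w: "vdot (xprod x d) w = 0" by simp
  \<comment> \<open>Removing the \<open>x\<close> component leaves a vector at infinity. There
    \<open>xprod u d\<close> has only a third component, which is minus the pairing that
    vanishes.\<close>
  define u where "u = w - w$3 *s x"
  have u3: "u$3 = 0" by (simp add: u_def x)
  have "vdot (xprod x d) u = 0" using w by (simp add: u_def)
  then have "xprod u d = 0"
    using x d u3 by (simp add: vdot_3 vec3_eq_iff algebra_simps)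
  then obtain k where "u = k *s d" using xprod_eq_0D d(2) by blast
  then show "w \<in> vec.span {x, d}"
    unfolding u_def by (auto simp: vec.span_breakdown_eq vec.span_singleton)
qed

lemma complex_line_eq:
  assumes "v \<noteq> 0"
  shows "complex_line q v = {w. vdot (xprod (cvec (hvec q)) (dvec v)) w = 0}"
  unfolding complex_line_def using assms
  by (intro span_point_direction) (auto simp: vec3_eq_iff vec2_eq_iff)

lemma plane_over_line:
  assumes v: "v \<noteq> 0"
  shows "plane_over {x + t *\<^sub>R v | t. True} = {w. vdot (xprod (hvec x) (dvec v)) w = 0}"
proof -
  have h: "hvec (x + t *\<^sub>R v) = hvec x + t *\<^sub>R dvec v" for t
    by (simp add: vec3_eq_iff)
  have "span (hvec ` {x + t *\<^sub>R v | t. True}) = span {hvec x, dvec v}"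
  proof (intro span_eq[THEN iffD2] conjI subsetI)
    fix y assume "y \<in> hvec ` {x + t *\<^sub>R v | t. True}"
    then obtain t where "y = hvec (x + t *\<^sub>R v)" by blast
    then have "y = hvec x + t *\<^sub>R dvec v" by (simp only: h)
    then show "y \<in> span {hvec x, dvec v}"
      by (simp add: span_add span_scale span_base)
  next
    fix y assume y: "y \<in> {hvec x, dvec v}"
    have "hvec (x + 0 *\<^sub>R v) \<in> span (hvec ` {x + t *\<^sub>R v | t. True})"
      "hvec (x + 1 *\<^sub>R v) \<in> span (hvec ` {x + t *\<^sub>R v | t. True})"
      by (intro span_base imageI; blast)+
    from this span_diff[OF this(2,1)] show "y \<in> span (hvec ` {x + t *\<^sub>R v | t. True})"
      using y unfolding h by auto
  qed
  also have "\<dots> = {w. vdot (xprod (hvec x) (dvec v)) w = 0}"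
    using v unfolding span_vec_eq[symmetric]
    by (intro span_point_direction) (auto simp: vec3_eq_iff vec2_eq_iff)
  finally show ?thesis by (simp add: plane_over_def)
qed

lemma linear_form_kernel_2:
  fixes k v :: "real^2"
  assumes "k \<noteq> 0"
  shows "k$1 * v$1 + k$2 * v$2 = 0 \<longleftrightarrow> (\<exists>t. v = t *\<^sub>R vector [- k$2, k$1])"
proof
  assume v: "k$1 * v$1 + k$2 * v$2 = 0"
  show "\<exists>t. v = t *\<^sub>R vector [- k$2, k$1]"
  proof (cases "k$1 = 0")
    case True
    then have "k$2 \<noteq> 0" using assms by (simp add: vec2_eq_iff)
    then have "v = (- v$1 / k$2) *\<^sub>R vector [- k$2, k$1]"
      using v True unfolding vec2_eq_iff by simp
    then show ?thesis by (rule exI)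
  next
    case False
    then have "v = (v$2 / k$1) *\<^sub>R vector [- k$2, k$1]"
      using v by (simp add: vec2_eq_iff field_simps add_eq_0_iff)
    then show ?thesis by (rule exI)
  qed
qed auto

text \<open>The join of \<open>hvec x\<close> with the direction \<open>(- l2, l1)\<close> is not
  merely proportional to \<open>l\<close> but equal to \<open>- l\<close>, so values of forms at the
  tangent direction become values at \<open>l\<close> up to sign.\<close>

lemma affine_tangent_eq:
  assumes l: "vdot l (hvec x) = 0" "l \<noteq> (0::real^3)"
  shows "{z. vdot l (hvec z) = 0} = {x + t *\<^sub>R vector [- l$2, l$1] | t. True}"
    "xprod (hvec x) (dvec (vector [- l$2, l$1])) = - l" "vector [- l$2, l$1] \<noteq> (0::real^2)"
proof -
  have l3: "l$3 = - (l$1 * x$1 + l$2 * x$2)" using l(1) by (simp add: vdot_3)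
  then show nz: "vector [- l$2, l$1] \<noteq> (0::real^2)"
    using l(2) by (cases "l$1 = 0") (auto simp: vec3_eq_iff vec2_eq_iff)
  show "xprod (hvec x) (dvec (vector [- l$2, l$1])) = - l"
    by (simp add: vec3_eq_iff l3)
  define k :: "real^2" where "k = vector [l$1, l$2]"
  have k: "k \<noteq> 0" using nz by (auto simp add: k_def vec2_eq_iff)
  have "vdot l (hvec z) = 0 \<longleftrightarrow> k$1 * (z - x)$1 + k$2 * (z - x)$2 = 0" for z
    by (simp add: k_def vdot_3 l3 algebra_simps)
  then have "vdot l (hvec z) = 0 \<longleftrightarrow> (\<exists>t. z = x + t *\<^sub>R vector [- l$2, l$1])" for z
    unfolding linear_form_kernel_2[OF k] by (simp add: k_def diff_eq_eq add.commute)
  then show "{z. vdot l (hvec z) = 0} = {x + t *\<^sub>R vector [- l$2, l$1] | t. True}" by auto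
qed

lemma affine_conic_vdot: "affine_conic C = {x. vdot (C *v hvec x) (hvec x) = 0}"
  by (simp add: affine_conic_def inner_eq_vdot)

lemma affine_tangent_vdot: "affine_tangent C x = {z. vdot (C *v hvec x) (hvec z) = 0}"
  by (simp add: affine_tangent_def inner_eq_vdot)

text \<open>The tangent at \<open>x\<close> has the real covector \<open>C *v hvec x\<close>, so
  \<open>is_tangent_to_iff\<close> turns complex tangency into one real equation.\<close>

lemma base_points_eq:
  assumes C: "regular_conic_matrix C" and S: "regular_conic_matrix S"
  shows "base_points C S = {x \<in> affine_conic C.
     vdot (matrix_inv S *v (C *v hvec x)) (C *v hvec x) = 0}"
proof -
  have "C *v hvec x \<noteq> 0" for x
    using regular_conic_matrixD(2)[OF C] invertible_mult_eq_0 hvec_neq_0 by blast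
  then have "is_tangent_to (complex_tangent C (cvec (hvec x))) S \<longleftrightarrow>
     vdot (matrix_inv S *v (C *v hvec x)) (C *v hvec x) = 0" for x
    using is_tangent_to_iff[OF S, of "cvec (C *v hvec x)"]
    by (simp add: complex_tangent_def cdot_eq_vdot)
  then show ?thesis by (auto simp: base_points_def)
qed

text \<open>Every root is nonzero because of \<open>a\<close>, and subtracting the equations at
  \<open>z\<close> and \<open>- z\<close> gives \<open>4 b z = 0\<close>. One root is therefore
  enough, and there is one unless \<open>b\<close> and \<open>c\<close> both vanish. A double root
  is allowed, which covers points of \<open>S\<close> with a single tangent.\<close>

lemma even_quadratic:
  fixes a b c :: complex
  assumes sym: "\<And>z. a + 2 * b * z + c * z\<^sup>2 = 0 \<Longrightarrow> a - 2 * b * z + c * z\<^sup>2 = 0" and a: "a \<noteq> 0"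
  shows "b = 0"
proof -
  have root: "b = 0" if "a + 2 * b * z + c * z\<^sup>2 = 0" for z
  proof -
    have "4 * b * z = (a + 2 * b * z + c * z\<^sup>2) - (a - 2 * b * z + c * z\<^sup>2)" by simp
    also have "\<dots> = 0" using that sym[OF that] by simp
    finally have "b = 0 \<or> z = 0" by simp
    then show ?thesis using that a by auto
  qed
  show ?thesis
  proof (cases "c = 0")
    case True
    show ?thesis
    proof (rule ccontr)
      assume "b \<noteq> 0"
      then have "a + 2 * b * (- a / (2 * b)) + c * (- a / (2 * b))\<^sup>2 = 0" using True by simp
      then show False using root \<open>b \<noteq> 0\<close> by blast
    qed
  next
    case False
    define z where "z = (- b + csqrt (b\<^sup>2 - a * c)) / c"
    have "(c * z + b)\<^sup>2 = b\<^sup>2 - a * c" using False by (simp add: z_def)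
    then have "c * (a + 2 * b * z + c * z\<^sup>2) = 0" by (simp add: power2_eq_square algebra_simps)
    then show ?thesis using False root by simp
  qed
qed

text \<open>\<open>J\<close> sends the direction \<open>d + z v\<close>, with \<open>d\<close>
  tangent and \<open>J v = - v\<close>, to \<open>d - z v\<close>. Tangency to \<open>S\<close> is a
  quadratic in \<open>z\<close> with nonzero constant term off the base points, so
  \<open>even_quadratic\<close> kills its mixed coefficient. This is one inclusion; the other
  follows because the right side is one-dimensional and the left side is nonzero.\<close>

lemma billiard_involution_eigenline:
  assumes C: "regular_conic_matrix C" and S: "regular_conic_matrix S"
    and x: "x \<in> punctured_conic C S" and J: "billiard_involution C S x J"
  shows "{v. J *v v = - v} =
     {v. vdot (matrix_inv S *v (C *v hvec x)) (xprod (hvec x) (dvec v)) = 0}"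
proof -
  note S' = regular_conic_matrixD[OF S]
  define T l where "T = matrix_inv S" and "l = C *v hvec x"
  have lx: "vdot l (hvec x) = 0" and Tl: "vdot (T *v l) l \<noteq> 0"
    using x by (auto simp: punctured_conic_def base_points_eq[OF C S] affine_conic_vdot T_def l_def)
  have l0: "l \<noteq> 0" using Tl by auto
  define d :: "real^2" where "d = vector [- l$2, l$1]"
  have d: "xprod (hvec x) (dvec d) = - l" "d \<noteq> 0"
    using affine_tangent_eq[OF lx l0] by (simp_all add: d_def)
  have JJ: "J *v (J *v v) = v" for v
    using J by (simp add: billiard_involution_def matrix_vector_mul_assoc)
  have perm: "is_tangent_to (complex_line x w) S \<longleftrightarrow> is_tangent_to (complex_line x (cmat J *v w)) S"
    if "w \<noteq> 0" for w
    using J that unfolding billiard_involution_def by blast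
  have fixed: "{v. J *v v = v} = {v. vdot l (dvec v) = 0}"
    using J by (simp add: billiard_involution_def tangent_direction_def l_def inner_eq_vdot)
  have "vdot l (dvec d) = 0" by (simp add: d_def vdot_3)
  then have Jd: "J *v d = d" using fixed by blast
  \<comment> \<open>\<open>B v = 0\<close> means that the line through \<open>x\<close> in direction
    \<open>v\<close> contains the pole \<open>T *v l\<close>; the nonzero value at \<open>d\<close>
    says that this pole is off the tangent.\<close>
  define B where "B v = vdot (T *v l) (xprod (hvec x) (dvec v))" for v
  have Bd: "B d \<noteq> 0" using Tl by (simp add: B_def d(1))
  have sub: "B v = 0" if v: "J *v v = - v" for v
  proof -
    let ?m = "\<lambda>v. xprod (hvec x) (dvec v)" and ?mc = "\<lambda>v. xprod (cvec (hvec x)) (dvec v)"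
    have tangent: "is_tangent_to (complex_line x w) S \<longleftrightarrow> vdot (cmat T *v ?mc w) (?mc w) = 0"
      if "w \<noteq> 0" for w
      unfolding complex_line_eq[OF that] T_def using that
      by (intro is_tangent_to_iff[OF S] xprod_hvec_dvec_neq_0) (auto simp: vec3_eq_iff vec2_eq_iff)
    define a b c where "a = vdot (T *v ?m d) (?m d)" and "b = vdot (T *v ?m d) (?m v)"
      and "c = vdot (T *v ?m v) (?m v)"
    have ba: "vdot (T *v ?m v) (?m d) = b" unfolding b_def T_def by (rule symmetric_vdot[OF S'(3)])
    have mc: "?mc (cvec d + z *s cvec v) = cvec (?m d) + z *s cvec (?m v)" for z
      by (simp add: vec3_eq_iff algebra_simps)
    have val: "vdot (cmat T *v ?mc (cvec d + z *s cvec v)) (?mc (cvec d + z *s cvec v)) =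
        of_real a + 2 * of_real b * z + of_real c * z\<^sup>2" for z
      unfolding mc by (simp add: mv_simps ba power2_eq_square algebra_simps
          flip: a_def b_def c_def)
    have Jc: "cmat J *v (cvec d + z *s cvec v) = cvec d + (- z) *s cvec v" for z
      by (simp add: mv_simps v Jd) (simp add: vec_eq_iff)
    have nz: "cvec d + z *s cvec v \<noteq> 0" for z
    proof
      assume e: "cvec d + z *s cvec v = 0"
      then have "cvec d + (- z) *s cvec v = 0" using Jc[of z] by simp
      with e have "cvec d = 0" by (simp add: vec_eq_iff)
      then show False using d(2) by simp
    qed
    have "of_real b = (0::complex)"
    proof (rule even_quadratic[of "of_real a" "of_real b" "of_real c"])
      fix z :: complex
      assume "of_real a + 2 * of_real b * z + of_real c * z\<^sup>2 = 0"
      then have "is_tangent_to (complex_line x (cvec d + z *s cvec v)) S"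
        using tangent[OF nz] val by simp
      then have "is_tangent_to (complex_line x (cvec d + (- z) *s cvec v)) S"
        using perm[OF nz[of z]] unfolding Jc by blast
      then show "of_real a - 2 * of_real b * z + of_real c * z\<^sup>2 = 0"
        using tangent[OF nz[of "- z"]] val[of "- z"] by simp
    next
      show "complex_of_real a \<noteq> 0" using Tl by (simp add: a_def d(1) mv_simps)
    qed
    then show ?thesis by (simp add: b_def B_def d(1) mv_simps)
  qed
  define k :: "real^2" where "k = vector [B (vector [1, 0]), B (vector [0, 1])]"
  have Bk: "B v = k$1 * v$1 + k$2 * v$2" for v
    by (simp add: k_def B_def vdot_3 algebra_simps)
  have "k \<noteq> 0" using Bd by (auto simp: Bk)
  then have ker: "B v = 0 \<longleftrightarrow> (\<exists>t. v = t *\<^sub>R vector [- k$2, k$1])" for v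
    unfolding Bk by (rule linear_form_kernel_2)
  \<comment> \<open>Otherwise every \<open>J *v v - v\<close>, which \<open>J\<close> negates, would
    vanish; \<open>J\<close> would be the identity and fix more than the tangent line.\<close>
  have "\<exists>w. w \<noteq> 0 \<and> J *v w = - w"
  proof (rule ccontr)
    assume "\<not> ?thesis"
    moreover have "J *v (J *v v - v) = - (J *v v - v)" for v
      by (simp add: matrix_vector_mult_diff_distrib JJ)
    ultimately have "J *v v - v = 0" for v by blast
    then have "vdot l (dvec v) = 0" for v using fixed by auto
    from this[of "vector [1, 0]"] this[of "vector [0, 1]"] show False
      using lx l0 by (simp add: vdot_3 vec3_eq_iff)
  qed
  then obtain w where w: "w \<noteq> 0" "J *v w = - w" by blast
  obtain s where s: "w = s *\<^sub>R vector [- k$2, k$1]" using sub[OF w(2)] unfolding ker by blast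
  have "J *v v = - v" if "B v = 0" for v
  proof -
    obtain t where t: "v = t *\<^sub>R vector [- k$2, k$1]" using \<open>B v = 0\<close> unfolding ker by blast
    have "s \<noteq> 0" using s w(1) by auto
    then have "v = (t / s) *s w" unfolding s t by (simp add: scalar_mult_eq_scaleR)
    then show ?thesis by (simp add: mv_simps w(2))
  qed
  then show ?thesis using sub unfolding B_def T_def l_def by blast
qed

text \<open>The line joining \<open>x\<close> to the pole of its tangent with respect to
  \<open>S\<close>; collinearity with the pole is written as a triple product, which is linear in
  \<open>v\<close>.\<close>

definition polar_normal :: "real^3^3 \<Rightarrow> real^3^3 \<Rightarrow> real^2 \<Rightarrow> (real^2) set" where
  "polar_normal C S x =
     {x + v | v. vdot (matrix_inv S *v (C *v hvec x)) (xprod (hvec x) (dvec v)) = 0}"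

lemma dual_pencil_billiard_normal:
  assumes "regular_conic_matrix C" "regular_conic_matrix S" "dual_pencil_billiard C S N"
    "x \<in> punctured_conic C S"
  shows "N x = polar_normal C S x"
proof -
  obtain J where J: "billiard_involution C S x J" "N x = {x + v | v. J *v v = - v}"
    using assms(3,4) by (auto simp: dual_pencil_billiard_def)
  then show ?thesis
    using billiard_involution_eigenline[OF assms(1,2,4) J(1)] by (auto simp: polar_normal_def)
qed

text \<open>Here \<open>n\<close> stands for the pole and \<open>l\<close> for the tangent covector.
  Since \<open>n\<close> is off the tangent, the linear form in \<open>w\<close> is nonzero at the
  tangent direction; its kernel is a single line of directions, different from the tangent.\<close>

lemma polar_normal_line:
  assumes n: "vdot n l \<noteq> 0" and l: "vdot l (hvec x) = (0::real)"
    and L: "v \<noteq> 0" "L = {x + t *\<^sub>R v | t. True}"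
  shows "{x + w | w. vdot n (xprod (hvec x) (dvec w)) = 0} = L \<longleftrightarrow>
     vdot n (xprod (hvec x) (dvec v)) = 0"
    "{x + w | w. vdot n (xprod (hvec x) (dvec w)) = 0} \<in> lines_through x"
    "{x + w | w. vdot n (xprod (hvec x) (dvec w)) = 0} \<noteq> {z. vdot l (hvec z) = 0}"
proof -
  define B where "B v = vdot n (xprod (hvec x) (dvec v))" for v
  define k :: "real^2" where "k = vector [B (vector [1, 0]), B (vector [0, 1])]"
  have Bk: "B v = k$1 * v$1 + k$2 * v$2" for v
    by (simp add: k_def B_def vdot_3 algebra_simps)
  define d :: "real^2" where "d = vector [- l$2, l$1]"
  have l0: "l \<noteq> 0" using n by auto
  note d = affine_tangent_eq[OF l l0, folded d_def]
  have Bd: "B d \<noteq> 0" using n by (simp add: B_def d(2))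
  have k0: "k \<noteq> 0" using Bd by (auto simp: Bk)
  define e :: "real^2" where "e = vector [- k$2, k$1]"
  have e0: "e \<noteq> 0" using k0 by (auto simp: e_def vec2_eq_iff)
  have ker: "B v = 0 \<longleftrightarrow> (\<exists>t. v = t *\<^sub>R e)" for v
    using linear_form_kernel_2[OF k0] unfolding Bk e_def .
  have eq: "{x + w | w. B w = 0} = {x + t *\<^sub>R e | t. True}" by (auto simp: ker)
  show "{x + w | w. vdot n (xprod (hvec x) (dvec w)) = 0} = L \<longleftrightarrow>
     vdot n (xprod (hvec x) (dvec v)) = 0"
    unfolding B_def[symmetric]
  proof
    assume "{x + w | w. B w = 0} = L"
    moreover have "x + 1 *\<^sub>R v \<in> L" unfolding L(2) by blast
    ultimately show "B v = 0" by auto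
  next
    assume "B v = 0"
    then obtain s where s: "v = s *\<^sub>R e" unfolding ker by blast
    with L(1) have "s \<noteq> 0" by auto
    then have "t *\<^sub>R e = (t / s) *\<^sub>R v" for t by (simp add: s)
    then have "\<exists>t'. t *\<^sub>R e = t' *\<^sub>R v" "\<exists>t'. t *\<^sub>R v = t' *\<^sub>R e" for t
      using s by (metis scaleR_scaleR)+
    then have "{x + t *\<^sub>R e | t. True} = L"
      unfolding L(2) by (metis (no_types, opaque_lifting))
    then show "{x + w | w. B w = 0} = L" using eq by simp
  qed
  show "{x + w | w. vdot n (xprod (hvec x) (dvec w)) = 0} \<in> lines_through x"
    unfolding B_def[symmetric] eq lines_through_def using e0 by blast
  have "x + d \<in> {z. vdot l (hvec z) = 0}" unfolding d(1) using scaleR_one by (metis (mono_tags) mem_Collect_eq)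
  moreover have "x + d \<notin> {x + w | w. B w = 0}" using Bd by auto
  ultimately show "{x + w | w. vdot n (xprod (hvec x) (dvec w)) = 0} \<noteq> {z. vdot l (hvec z) = 0}"
    unfolding B_def by blast
qed

lemma polar_normal_field_defined_by:
  assumes C: "regular_conic_matrix C" and S: "regular_conic_matrix S"
    and M: "invertible M" "\<beta> \<noteq> 0"
      "\<And>v. matrix_inv M *v v = \<alpha> *s (matrix_inv C *v v) + \<beta> *s (matrix_inv S *v v)"
    and N: "\<And>x. x \<in> punctured_conic C S \<Longrightarrow> N x = polar_normal C S x"
  shows "field_defined_by C (punctured_conic C S) M N"
  unfolding field_defined_by_def transversal_line_field_def
proof (intro conjI ballI)
  fix x assume x: "x \<in> punctured_conic C S"
  note C' = regular_conic_matrixD[OF C]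
  define l n where "l = C *v hvec x" and "n = matrix_inv S *v l"
  have lx: "vdot l (hvec x) = 0" and nl: "vdot n l \<noteq> 0"
    using x by (auto simp: punctured_conic_def base_points_eq[OF C S] affine_conic_vdot n_def l_def)
  have l0: "l \<noteq> 0" using nl by auto
  have Nx: "N x = {x + w | w. vdot n (xprod (hvec x) (dvec w)) = 0}"
    using N[OF x] by (simp add: polar_normal_def n_def l_def)
  have T: "affine_tangent C x = {z. vdot l (hvec z) = 0}"
    by (simp add: affine_tangent_vdot l_def)
  have e: "vector [1, 0] \<noteq> (0 :: real^2)" by (simp add: vec2_eq_iff)
  note normal = polar_normal_line[OF nl lx]
  show "N x \<in> lines_through x" "N x \<noteq> affine_tangent C x"
    unfolding Nx T using normal(2,3)[OF e refl] by blast+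
  fix L assume "L \<in> lines_through x"
  then obtain v where v: "v \<noteq> 0" "L = {x + t *\<^sub>R v | t. True}"
    by (auto simp: lines_through_def)
  have PT: "plane_over (affine_tangent C x) = {w. vdot l w = 0}"
    unfolding T affine_tangent_eq(1)[OF lx l0]
      plane_over_line[OF affine_tangent_eq(3)[OF lx l0]] affine_tangent_eq(2)[OF lx l0] by simp
  \<comment> \<open>The complement of the tangent plane is spanned by its \<open>M\<close>-pole:
    \<open>M *v u\<close> has to be proportional to the covector \<open>l\<close>.\<close>
  have "{u. \<forall>w\<in>{w. vdot l w = 0}. vdot (M *v u) w = 0} = {k *s (matrix_inv M *v l) | k. True}"
  proof (intro equalityI subsetI)
    fix u assume "u \<in> {u. \<forall>w\<in>{w. vdot l w = 0}. vdot (M *v u) w = 0}"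
    then obtain k where "M *v u = k *s l"
      using kernel_subset_imp_multiple[of l "M *v u"] l0 by blast
    then have "u = k *s (matrix_inv M *v l)" using M(1) by (metis matrix_inv_cancel(2) vector_scalar_commute)
    then show "u \<in> {k *s (matrix_inv M *v l) | k. True}" by blast
  qed (auto simp: mv_simps M(1))
  also have "matrix_inv M *v l = \<alpha> *s hvec x + \<beta> *s n"
    unfolding M(3) n_def by (simp add: l_def C'(2))
  finally have "form_orthogonal M (plane_over (affine_tangent C x)) (plane_over L) \<longleftrightarrow>
      {k *s (\<alpha> *s hvec x + \<beta> *s n) | k. True} \<subseteq> {w. vdot (xprod (hvec x) (dvec v)) w = 0}"
    unfolding form_orthogonal_def PT v(2) plane_over_line[OF v(1)] inner_eq_vdot by simp
  \<comment> \<open>The plane over \<open>L\<close> already contains \<open>hvec x\<close>; as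
    \<beta> is nonzero, it contains the \<open>M\<close>-pole exactly if it contains
    \<open>n\<close>.\<close>
  also have "\<dots> \<longleftrightarrow> vdot n (xprod (hvec x) (dvec v)) = 0"
    using M(2) by (auto simp: vdot_commute[of "xprod _ _" n])
  also have "\<dots> \<longleftrightarrow> L = N x" unfolding Nx using normal(1)[OF v] by blast
  finally show "L = N x \<longleftrightarrow> form_orthogonal M (plane_over (affine_tangent C x)) (plane_over L)"
    by blast
qed

section \<open>Parametrization of a conic and its base points\<close>

text \<open>Up to scale of the points this is the substitution of \<open>1 / t\<close> for
  \<open>t\<close>; it moves \<open>p\<close> to the parameter infinity.\<close>

lemma conic_frame_swap:
  assumes "conic_frame C p e f a"
  shows "conic_frame C f e p a"
  using conic_frameD[OF assms] by (simp add: conic_frame_def)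

lemma conic_frame_scale:
  "conic_frame C p e f a \<Longrightarrow> d \<noteq> 0 \<Longrightarrow> conic_frame C p (d *s e) (d\<^sup>2 *s f) (d\<^sup>2 * a)"
  by (simp add: conic_frame_def mv_simps power2_eq_square)

lemma frame_point_scale: "frame_point p (d *s e) (d\<^sup>2 *s f) t = frame_point p e f (d * t)"
  by (simp add: frame_point_def vector_smult_assoc power2_eq_square mult_ac)

text \<open>Inverse of the rational parametrization. It has degree zero in \<open>v\<close>, so it
  applies to any representative of a point, in the affine plane or on the hyperboloid.\<close>

definition frame_coord :: "'a::field^3^3 \<Rightarrow> 'a^3 \<Rightarrow> 'a^3 \<Rightarrow> 'a^3 \<Rightarrow> 'a" where
  "frame_coord C e f v = - vdot (C *v e) v / (2 * vdot (C *v f) v)"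

lemma frame_point_pairing:
  assumes "conic_frame C p e f a"
  shows "vdot (C *v f) (frame_point p e f t) = a"
    "vdot (C *v e) (frame_point p e f t) = - 2 * a * t"
  using conic_frameD[OF assms] by (simp_all add: frame_point_def)

lemma frame_coord_point:
  fixes C :: "'a::field_char_0^3^3"
  assumes "conic_frame C p e f a" "k \<noteq> 0"
  shows "frame_coord C e f (k *s frame_point p e f t) = t"
  using conic_frameD(2)[OF assms(1)] assms(2)
  by (simp add: frame_coord_def frame_point_pairing[OF assms(1)])

lemma isotropic_eq_frame_point:
  fixes C :: "'a::field_char_0^3^3"
  assumes fr: "conic_frame C p e f a" and v: "vdot (C *v v) v = 0" and nz: "vdot (C *v f) v \<noteq> 0"
  shows "v = (vdot (C *v f) v / a) *s frame_point p e f (frame_coord C e f v)"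
proof -
  note F = conic_frameD[OF fr]
  define x y z where "x = vdot (C *v f) v / a" and "y = vdot (C *v e) v / (- 2 * a)"
    and "z = vdot (C *v p) v / a"
  have dec: "v = x *s p + y *s e + z *s f"
    unfolding x_def y_def z_def by (rule conic_frame_decomp[OF fr])
  have x0: "x \<noteq> 0" using nz F(2) by (simp add: x_def)
  have "x * z = y\<^sup>2" using v F(2) conic_frame_quadratic[OF fr, of x y z] by (simp flip: dec)
  then have z: "z = x * (y / x)\<^sup>2" using x0 by (simp add: power2_eq_square field_simps)
  have "frame_coord C e f v = y / x" using F(2) by (simp add: frame_coord_def x_def y_def)
  then have "x *s frame_point p e f (frame_coord C e f v) = x *s p + y *s e + z *s f"
    using x0 unfolding z by (simp add: frame_point_def vector_add_ldistrib vector_smult_assoc)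
  then show ?thesis using dec unfolding x_def by simp
qed

text \<open>The tangent at \<open>f\<close> meets the conic only in \<open>f\<close>: in frame
  coordinates \<open>x z = y^2\<close> and \<open>x = 0\<close> force \<open>y = 0\<close>.\<close>

lemma isotropic_at_infinity:
  fixes C :: "'a::field_char_0^3^3"
  assumes fr: "conic_frame C p e f a" and v: "vdot (C *v v) v = 0" and z: "vdot (C *v f) v = 0"
  shows "v = (vdot (C *v p) v / a) *s f"
proof -
  define y where "y = vdot (C *v e) v / (- 2 * a)"
  have dec: "v = 0 *s p + y *s e + (vdot (C *v p) v / a) *s f"
    using conic_frame_decomp[OF fr, of v] unfolding y_def z by simp
  have "y = 0"
    using v conic_frameD(2)[OF fr]
      conic_frame_quadratic[OF fr, of 0 y "vdot (C *v p) v / a", folded dec] by simp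
  then show ?thesis using dec by simp
qed

section \<open>The number of base points\<close>

lemma hvec_multiple_unique: "hvec x = k *s v \<Longrightarrow> hvec y = l *s v \<Longrightarrow> x = y"
  for x y :: "'a::field^2"
proof -
  assume 1: "hvec x = k *s v" and 2: "hvec y = l *s v"
  have "k * v$3 = 1" "l * v$3 = 1"
    using arg_cong[OF 1, of "\<lambda>w. w$3"] arg_cong[OF 2, of "\<lambda>w. w$3"] by simp_all
  then have "k = l" by (metis mult_cancel_right mult_zero_right zero_neq_one)
  then have "hvec x = hvec y" using 1 2 by simp
  then show "x = y" by (simp add: vec3_eq_iff vec2_eq_iff)
qed

text \<open>Cancelling the outer and then the inner factor \<open>C\<close> would make
  \<open>C\<close> a multiple of \<open>S\<close>.\<close>

lemma not_multiple_of_distinct_conic: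
  fixes C S :: "real^3^3"
  assumes C: "regular_conic_matrix C" and S: "regular_conic_matrix S"
    and distinct: "complex_conic (cmat S) \<noteq> complex_conic (cmat C)"
    and k: "\<And>v. C *v (matrix_inv S *v (C *v v)) = k *s (C *v v)"
  shows False
proof -
  note C' = regular_conic_matrixD[OF C] and S' = regular_conic_matrixD[OF S]
  have "cmat C *v v = of_real k *s (cmat S *v v)" for v
  proof -
    have eq: "C *v v = k *s (S *v v)" for v
    proof -
      have "matrix_inv S *v (C *v v) = k *s v"
        using arg_cong[OF k, of "\<lambda>w. matrix_inv C *v w"] by (simp add: C' mv_simps)
      from arg_cong[OF this, of "\<lambda>w. S *v w"] show ?thesis by (simp add: S' mv_simps)
    qed
    have "C $ i $ j = k * S $ i $ j" for i j
      using arg_cong[OF eq[of "axis j 1"], of "\<lambda>w. w $ i"]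
      by (simp add: matrix_vector_mult_def axis_def if_distrib cong: if_cong)
    then show ?thesis by (simp add: vec_eq_iff matrix_vector_mult_def sum_distrib_left mult.assoc)
  qed
  moreover from this have "complex_of_real k \<noteq> 0"
  proof (rule_tac notI)
    assume "\<And>v. cmat C *v v = of_real k *s (cmat S *v v)" "complex_of_real k = 0"
    then have "cmat C *v 1 = 0" by simp
    then show False
      using invertible_mult_eq_0[OF invertible_cmat_inv(1)[OF C'(2)]] by (metis zero_neq_one)
  qed
  ultimately show False using complex_conic_multiple distinct by metis
qed

text \<open>
  With a base point at infinity, the others correspond to roots of a nonzero polynomial of
  degree at most three.
\<close>

lemma base_points_card:
  fixes C S :: "real^3^3"
  assumes C: "regular_conic_matrix C" and S: "regular_conic_matrix S"
    and distinct: "complex_conic (cmat S) \<noteq> complex_conic (cmat C)"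
  shows "finite (base_points C S) \<and> card (base_points C S) \<le> 4"
proof (cases "base_points C S = {}")
  case False
  note C' = regular_conic_matrixD[OF C] and S' = regular_conic_matrixD[OF S]
  \<comment> \<open>\<open>Q\<close> transports the dual form of \<open>S\<close> from tangent
    covectors \<open>C *v v\<close> to points \<open>v\<close>.\<close>
  define Q where "Q = C ** (matrix_inv S ** C)"
  have Q: "Q *v v = C *v (matrix_inv S *v (C *v v))" for v
    by (simp add: Q_def matrix_vector_mul_assoc)
  have Qv: "vdot (matrix_inv S *v (C *v v)) (C *v v) = vdot (Q *v v) v" for v
    unfolding Q by (metis symmetric_vdot[OF C'(1)] vdot_commute)
  have symQ: "symmetric_matrix Q"
    using C'(1) S'(3) by (simp add: Q_def symmetric_matrix_def matrix_transpose_mul matrix_mul_assoc)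
  have mem: "x \<in> base_points C S \<longleftrightarrow>
      vdot (C *v hvec x) (hvec x) = 0 \<and> vdot (Q *v hvec x) (hvec x) = 0" for x
    by (simp add: base_points_eq[OF C S] affine_conic_vdot Qv)
  from False obtain x0 where x0: "x0 \<in> base_points C S" by blast
  define p where "p = hvec x0"
  have p: "vdot (C *v p) p = 0" "vdot (Q *v p) p = 0" "p \<noteq> 0"
    using x0 by (simp_all add: mem p_def)
  \<comment> \<open>\<open>p\<close> takes the last place of the frame, so
    \<open>vdot (Q *v p) p = 0\<close> removes the term of degree four.\<close>
  obtain f e a where fr: "conic_frame C f e p a"
    using conic_frame_exists[OF C'(1,2) p(3,1)] conic_frame_swap by metis
  define c :: "nat \<Rightarrow> real" where "c i = (if i = 0 then vdot (Q *v f) f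
    else if i = 1 then 2 * vdot (Q *v f) e
    else if i = 2 then vdot (Q *v e) e + 2 * vdot (Q *v f) p else 2 * vdot (Q *v e) p)" for i
  have poly: "vdot (Q *v frame_point f e p t) (frame_point f e p t) = (\<Sum>i\<le>3. c i * t ^ i)" for t
    using p(2) symmetric_vdot[OF symQ, of p f] symmetric_vdot[OF symQ, of p e]
      symmetric_vdot[OF symQ, of e f]
    by (simp add: c_def frame_point_def mv_simps numeral_3_eq_3 power2_eq_square algebra_simps)
  have "\<exists>k\<le>3. c k \<noteq> 0"
  proof (rule ccontr)
    assume "\<not> ?thesis"
    then have "c 0 = 0" "c 1 = 0" "c 2 = 0" "c 3 = 0" by auto
    then obtain k where "\<And>v. Q *v v = k *s (C *v v)"
      using quadratic_form_multiple[OF fr symQ] p(2) by (auto simp: c_def)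
    then show False using not_multiple_of_distinct_conic[OF C S distinct] Q by metis
  qed
  then have roots: "finite {t. (\<Sum>i\<le>3. c i * t ^ i) = 0}" "card {t. (\<Sum>i\<le>3. c i * t ^ i) = 0} \<le> 3"
    using polyfun_rootbound[where c = c and n = 3] by blast+
  define h where "h x = frame_coord C e p (hvec x)" for x
  have pt: "\<exists>k. k \<noteq> 0 \<and> hvec x = k *s frame_point f e p (h x)"
    if x: "x \<in> base_points C S - {x0}" for x
  proof -
    have iso: "vdot (C *v hvec x) (hvec x) = 0" using x by (simp add: mem)
    have nz: "vdot (C *v p) (hvec x) \<noteq> 0"
    proof
      assume "vdot (C *v p) (hvec x) = 0"
      then have "hvec x = (vdot (C *v f) (hvec x) / a) *s p" "hvec x0 = 1 *s p"
        using isotropic_at_infinity[OF fr iso] by (simp_all add: p_def)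
      then have "x = x0" by (rule hvec_multiple_unique)
      then show False using x by simp
    qed
    then have "vdot (C *v p) (hvec x) / a \<noteq> 0" using conic_frameD(2)[OF fr] by simp
    then show ?thesis using isotropic_eq_frame_point[OF fr iso nz] unfolding h_def by blast
  qed
  have inj: "inj_on h (base_points C S - {x0})"
  proof (rule inj_onI)
    fix x y assume "x \<in> base_points C S - {x0}" "y \<in> base_points C S - {x0}" "h x = h y"
    then show "x = y" using pt[of x] pt[of y] hvec_multiple_unique by metis
  qed
  have "h ` (base_points C S - {x0}) \<subseteq> {t. (\<Sum>i\<le>3. c i * t ^ i) = 0}"
  proof (rule image_subsetI)
    fix x assume x: "x \<in> base_points C S - {x0}"
    then obtain k where k: "k \<noteq> 0" "hvec x = k *s frame_point f e p (h x)" using pt by blast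
    have "vdot (Q *v hvec x) (hvec x) = 0" using x mem by blast
    then have "vdot (Q *v frame_point f e p (h x)) (frame_point f e p (h x)) = 0"
      unfolding k(2) using k(1) by (simp add: mv_simps)
    then show "h x \<in> {t. (\<Sum>i\<le>3. c i * t ^ i) = 0}" by (simp add: poly)
  qed
  then have fin: "finite (base_points C S - {x0})" and "card (base_points C S - {x0}) \<le> 3"
    using roots inj inj_on_finite card_inj_on_le[OF inj] by (blast, meson order_trans)
  then show ?thesis using x0 by (simp add: card_Diff_singleton)
qed simp

section \<open>A member of the pencil of Lorentz signature\<close>

lemma symmetric_matrix_add_scaleR:
  fixes A B :: "real^'n^'n"
  shows "symmetric_matrix A \<Longrightarrow> symmetric_matrix B \<Longrightarrow> symmetric_matrix (A + c *\<^sub>R B)"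
  by (simp add: symmetric_matrix_def vec_eq_iff transpose_def)

lemma scaleR_matrix_vector [simp]: "(c *\<^sub>R A) *v v = c *s (A *v v)" for A :: "real^'n^'m"
  by (simp add: scaleR_matrix_vector_assoc[symmetric] scalar_mult_eq_scaleR)

lemma vdot_le_norm: "\<bar>vdot u v\<bar> \<le> norm u * norm v" for u v :: "real^'n"
  unfolding inner_eq_vdot[symmetric] by (rule Cauchy_Schwarz_ineq2)

text \<open>With \<open>v = M *v n\<close> one has
  \<open><M p, p> = - \<epsilon> (s - \<epsilon> <v, n>)\<close>, so a bound on \<open>v\<close>
  uniform in \<epsilon> replaces differentiation of the inverse matrix. The vector \<open>b\<close>
  is supplied because a negative determinant and one negative direction would still allow a negative
  definite form.\<close>

lemma lorentz_pencil_member: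
  fixes C T :: "real^3^3"
  assumes C: "symmetric_matrix C" "invertible C" "det C < 0" and T: "symmetric_matrix T"
    and p: "vdot (C *v p) p = 0" and pos: "vdot (T *v (C *v p)) (C *v p) > 0"
  obtains \<epsilon> M b where "\<epsilon> \<noteq> 0" "symmetric_matrix M" "invertible M" "det M < 0"
    "\<And>v. matrix_inv M *v v = matrix_inv C *v v + \<epsilon> *s (T *v v)"
    "vdot (M *v p) p < 0" "vdot (M *v b) b > 0"
proof -
  define l n where "l = C *v p" and "n = T *v l"
  define s where "s = vdot n l"
  define W where "W \<epsilon> = matrix_inv C + \<epsilon> *\<^sub>R T" for \<epsilon>
  have s0: "s > 0" using pos by (simp add: s_def n_def l_def)
  have W: "W \<epsilon> *v v = matrix_inv C *v v + \<epsilon> *s (T *v v)" for \<epsilon> v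
    by (simp add: W_def matrix_vector_mult_add_rdistrib)
  \<comment> \<open>\<open>B\<close> bounds the operator \<open>C ** T\<close>; the condition
    \<open>\<epsilon> * B < 1 / 2\<close> later absorbs the error term in the estimate of
    \<open>v\<close>.\<close>
  obtain B where B: "B > 0" "\<And>v. norm ((C ** T) *v v) \<le> norm v * B"
    using bounded_linear.pos_bounded[OF matrix_vector_mul_bounded_linear[of "C ** T"]] by blast
  have "det C * det (matrix_inv C) = 1"
    using C(2) by (metis det_I det_mul invertible_matrix_inv(1))
  then have det0: "det (W 0) < 0" using C(3) by (simp add: W_def) (smt (verit) mult_nonpos_nonneg)
  have "((\<lambda>\<epsilon>. det (W \<epsilon>)) \<longlongrightarrow> det (W 0)) (at_right 0)"
    unfolding det_3 W_def by (auto intro!: tendsto_eq_intros)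
  then have "\<forall>\<^sub>F \<epsilon> in at_right 0. det (W \<epsilon>) < 0" using det0 by (rule order_tendstoD)
  moreover have "((\<lambda>\<epsilon>. \<epsilon> * B) \<longlongrightarrow> 0) (at_right 0)" by (auto intro!: tendsto_eq_intros)
  then have "\<forall>\<^sub>F \<epsilon> in at_right 0. \<epsilon> * B < 1 / 2" by (rule order_tendstoD) simp
  moreover have "((\<lambda>\<epsilon>. \<epsilon> * (2 * norm (C *v n) * norm n)) \<longlongrightarrow> 0) (at_right 0)"
    by (auto intro!: tendsto_eq_intros)
  then have "\<forall>\<^sub>F \<epsilon> in at_right 0. \<epsilon> * (2 * norm (C *v n) * norm n) < s"
    using s0 by (rule order_tendstoD)
  moreover have "\<forall>\<^sub>F \<epsilon> in at_right 0. \<epsilon> > (0::real)" by (simp add: eventually_at_right_less)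
  ultimately have "\<forall>\<^sub>F \<epsilon> in at_right 0. det (W \<epsilon>) < 0 \<and> \<epsilon> * B < 1 / 2 \<and>
      \<epsilon> * (2 * norm (C *v n) * norm n) < s \<and> \<epsilon> > 0"
    by eventually_elim auto
  then obtain \<epsilon> where e: "det (W \<epsilon>) < 0" "\<epsilon> * B < 1 / 2"
      "\<epsilon> * (2 * norm (C *v n) * norm n) < s" "\<epsilon> > 0"
    using eventually_happens'[OF trivial_limit_at_right_real] by blast
  define M where "M = matrix_inv (W \<epsilon>)"
  have Wi: "invertible (W \<epsilon>)" using e(1) by (simp add: invertible_det_nz)
  have WM: "W \<epsilon> *v (M *v v) = v" "M *v (W \<epsilon> *v v) = v" for v by (simp_all add: M_def Wi)
  have Wsym: "symmetric_matrix (W \<epsilon>)"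
    unfolding W_def by (intro symmetric_matrix_add_scaleR symmetric_matrix_inv C T)
  have Msym: "symmetric_matrix M" unfolding M_def by (rule symmetric_matrix_inv[OF Wsym Wi])
  have detM: "det M < 0"
  proof -
    have "det (W \<epsilon>) * det M = 1" using Wi by (metis M_def det_I det_mul invertible_matrix_inv(1))
    then show ?thesis using e(1) by (smt (verit) mult_nonpos_nonneg)
  qed
  have Wl: "W \<epsilon> *v l = p + \<epsilon> *s n" by (simp add: W l_def n_def C(2))
  have lp: "vdot l p = 0" using p by (simp add: l_def)
  \<comment> \<open>\<open>M\<close> undoes \<open>W \<epsilon>\<close>, so the form at
    \<open>W \<epsilon> *v l = p + \<epsilon> *s n\<close> is the pairing with \<open>l\<close>,
    which vanishes at \<open>p\<close>.\<close>
  have "vdot (M *v (W \<epsilon> *v l)) (W \<epsilon> *v l) = \<epsilon> * s"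
    unfolding WM(2) unfolding Wl by (simp add: lp s_def vdot_commute[of l n])
  then have b: "vdot (M *v (W \<epsilon> *v l)) (W \<epsilon> *v l) > 0" using e(4) s0 by simp
  \<comment> \<open>\<open>v\<close> satisfies \<open>v = C n - \<epsilon> C T v\<close>; half of
    its norm is absorbed on the left, leaving a bound free of \<epsilon>.\<close>
  define v where "v = M *v n"
  have "matrix_inv C *v v + \<epsilon> *s (T *v v) = n" using WM(1)[of n] by (simp add: W v_def)
  then have "C *v (matrix_inv C *v v + \<epsilon> *s (T *v v)) = C *v n" by simp
  then have "v = C *v n - \<epsilon> *s ((C ** T) *v v)"
    by (simp add: mv_simps C(2) matrix_vector_mul_assoc[symmetric] eq_diff_eq)
  then have "norm v \<le> norm (C *v n) + norm (\<epsilon> *s ((C ** T) *v v))"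
    by (metis norm_triangle_ineq4)
  also have "norm (\<epsilon> *s ((C ** T) *v v)) \<le> \<epsilon> * (norm v * B)"
    using e(4) B(2)[of v] by (simp add: scalar_mult_eq_scaleR)
  also have "\<dots> = (\<epsilon> * B) * norm v" by simp
  also have "\<dots> \<le> (1 / 2) * norm v" using e(2) by (intro mult_right_mono) auto
  finally have nv: "norm v \<le> 2 * norm (C *v n)" by simp
  have "\<epsilon> * vdot v n \<le> \<epsilon> * (norm v * norm n)"
    using vdot_le_norm[of v n] e(4) by (intro mult_left_mono) auto
  also have "\<dots> \<le> \<epsilon> * (2 * norm (C *v n) * norm n)"
    using nv e(4) by (intro mult_left_mono mult_right_mono) auto
  finally have small: "\<epsilon> * vdot v n < s" using e(3) by simp
  have "M *v p = l - \<epsilon> *s v"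
    using WM(2)[of l] unfolding Wl v_def by (simp add: mv_simps eq_diff_eq)
  then have "vdot (M *v p) p = - \<epsilon> * vdot (M *v n) p" by (simp add: lp v_def)
  also have "vdot (M *v n) p = vdot (M *v p) n" by (rule symmetric_vdot[OF Msym])
  also have "\<dots> = s - \<epsilon> * vdot v n"
    unfolding \<open>M *v p = l - \<epsilon> *s v\<close> by (simp add: s_def vdot_commute)
  finally have neg: "vdot (M *v p) p < 0" using small e(4) by simp
  have Minv: "matrix_inv M = W \<epsilon>" unfolding M_def by (rule matrix_inv_inv[OF Wi])
  show thesis
    using that[of \<epsilon> M "W \<epsilon> *v l"] e(4) Msym detM b neg W Minv
    by (simp add: invertible_det_nz)
qed

definition lorentz :: "real^3 \<Rightarrow> real^3 \<Rightarrow> real" where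
  "lorentz u v = u$1 * v$1 + u$2 * v$2 - u$3 * v$3"

text \<open>Gram-Schmidt on \<open>p\<close> and \<open>b\<close>, completed by a vector orthogonal
  to both, diagonalizes \<open>M\<close> with one negative and one positive entry; the sign of the
  determinant makes the third entry positive.\<close>

lemma lorentz_normal_form:
  fixes M :: "real^3^3"
  assumes M: "symmetric_matrix M" "det M < 0" and p: "vdot (M *v p) p < 0" and b: "vdot (M *v b) b > 0"
  obtains P where "invertible P" "(P *v p) $ 3 > 0"
    "\<And>u v. vdot (M *v u) v = lorentz (P *v u) (P *v v)"
proof -
  have Mi: "invertible M" using M(2) by (simp add: invertible_det_nz)
  define \<pi> where "\<pi> = vdot (M *v p) p"
  define b' where "b' = b - (vdot (M *v b) p / \<pi>) *s p"
  have \<pi>: "\<pi> < 0" using p by (simp add: \<pi>_def)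
  have b'p: "vdot (M *v b') p = 0" using \<pi> by (simp add: b'_def mv_simps flip: \<pi>_def)
  have pb': "vdot (M *v p) b' = 0" using b'p symmetric_vdot[OF M(1)] by metis
  define \<beta> where "\<beta> = vdot (M *v b') b'"
  have "\<beta> = vdot (M *v b) b - (vdot (M *v b) p)\<^sup>2 / \<pi>"
    using b'p unfolding \<beta>_def
    by (subst (2) b'_def) (simp add: b'_def mv_simps symmetric_vdot[OF M(1), of p b] power2_eq_square)
  moreover have "(vdot (M *v b) p)\<^sup>2 / \<pi> \<le> 0" using \<pi> by (simp add: divide_nonneg_neg)
  ultimately have \<beta>: "\<beta> > 0" using b by simp
  define c where "c = xprod (M *v p) (M *v b')"
  have pc: "vdot (M *v p) c = 0" and b'c: "vdot (M *v b') c = 0"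
    unfolding c_def by (simp_all add: vdot_commute[of _ "xprod _ _"])
  have cp: "vdot (M *v c) p = 0" and cb': "vdot (M *v c) b' = 0"
    using pc b'c symmetric_vdot[OF M(1)] by metis+
  have c0: "c \<noteq> 0"
  proof
    assume "c = 0"
    moreover have "M *v b' \<noteq> 0" using \<beta> by (auto simp: \<beta>_def)
    ultimately obtain k where "M *v p = k *s (M *v b')" unfolding c_def using xprod_eq_0D by blast
    then have "\<pi> = 0" unfolding \<pi>_def using b'p by simp
    then show False using \<pi> by simp
  qed
  define \<kappa> where "\<kappa> = vdot (M *v c) c"
  define E where "E = transpose (vector [b', c, p] :: real^3^3)"
  have E: "E *v w = w$1 *s b' + w$2 *s c + w$3 *s p" for w
    by (simp add: E_def vec3_eq_iff matrix_vector_mult_def sum_3 transpose_def algebra_simps)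
  have form: "vdot (M *v (E *v w)) (E *v w') = \<beta> * w$1 * w'$1 + \<kappa> * w$2 * w'$2 + \<pi> * w$3 * w'$3"
    for w w'
    unfolding E by (simp add: mv_simps b'p pb' pc cp b'c cb' flip: \<beta>_def \<kappa>_def \<pi>_def)
  have Ei: "invertible E"
  proof -
    \<comment> \<open>The sign of \<kappa> is not yet known, so the form controls only the first and
      third coordinates; the second one follows from \<open>c0\<close>.\<close>
    have "w = 0" if "E *v w = 0" for w
    proof -
      have "\<beta> * w$1 = 0" "\<pi> * w$3 = 0"
        using form[of w "axis 1 1"] form[of w "axis 3 1"] that by (simp_all add: axis_def)
      then have w: "w$1 = 0" "w$3 = 0" using \<beta> \<pi> by auto
      then have "w$2 *s c = 0" using that by (simp add: E)
      then have "w$2 = 0" using c0 by simp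
      then show ?thesis using w by (simp add: vec3_eq_iff)
    qed
    then show ?thesis by (metis invertible_left_inverse matrix_left_invertible_ker)
  qed
  define G where "G = (vector [vector [\<beta>, 0, 0], vector [0, \<kappa>, 0], vector [0, 0, \<pi>]] :: real^3^3)"
  have "transpose E ** M ** E = G"
  proof (rule matrix_eqI_vector)
    fix w
    have "vdot ((transpose E ** M ** E) *v w) w' = vdot (G *v w) w'" for w'
    proof -
      have "vdot ((transpose E ** M ** E) *v w) w' = vdot (M *v (E *v w)) (E *v w')"
        by (simp only: matrix_vector_mul_assoc[symmetric] transpose_vdot[of "transpose E"]
            transpose_transpose)
      also have "\<dots> = vdot (G *v w) w'"
        unfolding form by (simp add: G_def matrix_vector_mult_3 vdot_3)
      finally show ?thesis .
    qed
    then have "vdot ((transpose E ** M ** E) *v w - G *v w) w' = 0" for w' by simp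
    then show "(transpose E ** M ** E) *v w = G *v w" using vdot_all_eq_0 by (metis eq_iff_diff_eq_0)
  qed
  then have "det E * det M * det E = det G" by (metis det_mul det_transpose)
  also have "det G = \<beta> * \<kappa> * \<pi>" by (simp add: G_def det_3)
  finally have "\<beta> * \<kappa> * \<pi> = (det E)\<^sup>2 * det M" by (simp add: power2_eq_square mult_ac)
  also have "\<dots> < 0" using Ei M(2) by (simp add: invertible_det_nz mult_pos_neg)
  finally have \<kappa>: "\<kappa> > 0" using \<beta> \<pi> by (simp add: mult_less_0_iff zero_less_mult_iff)
  define H where "H = (vector [vector [sqrt \<beta>, 0, 0], vector [0, sqrt \<kappa>, 0], vector [0, 0, sqrt (- \<pi>)]] :: real^3^3)"
  have H: "H *v w = vector [sqrt \<beta> * w$1, sqrt \<kappa> * w$2, sqrt (- \<pi>) * w$3]" for w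
    by (simp add: H_def matrix_vector_mult_3 vdot_3)
  have Hi: "invertible H" using \<beta> \<kappa> \<pi> by (simp add: invertible_det_nz H_def det_3)
  define P where "P = H ** matrix_inv E"
  have P: "P *v u = H *v (matrix_inv E *v u)" for u by (simp add: P_def matrix_vector_mul_assoc)
  have sq: "(sqrt r * x) * (sqrt r * y) = r * x * y" if "r \<ge> 0" for r x y
  proof -
    have "(sqrt r * x) * (sqrt r * y) = (sqrt r * sqrt r) * x * y" by (simp only: mult_ac)
    then show ?thesis using that by simp
  qed
  have "invertible P" unfolding P_def by (intro invertible_mult Hi invertible_inv Ei)
  moreover have "(P *v p) $ 3 > 0"
  proof -
    have "p = E *v axis 3 1" by (simp add: E axis_def)
    then have "matrix_inv E *v p = axis 3 1" using Ei by simp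
    then show ?thesis using \<pi> by (simp add: P H axis_def)
  qed
  moreover have "vdot (M *v u) v = lorentz (P *v u) (P *v v)" for u v
  proof -
    have "vdot (M *v u) v = vdot (M *v (E *v (matrix_inv E *v u))) (E *v (matrix_inv E *v v))"
      using Ei by simp
    also have "\<dots> = lorentz (P *v u) (P *v v)"
      unfolding form P H lorentz_def using \<beta> \<kappa> \<pi> by (simp add: sq)
    finally show ?thesis .
  qed
  ultimately show thesis by (rule that)
qed

section \<open>Lifting an arc of the conic to the hyperbolic plane\<close>

lemma continuous_on_vdot [continuous_intros]:
  fixes u v :: "'a::topological_space \<Rightarrow> real^'n"
  shows "continuous_on S u \<Longrightarrow> continuous_on S v \<Longrightarrow> continuous_on S (\<lambda>x. vdot (u x) (v x))"
  unfolding inner_eq_vdot[symmetric] by (rule continuous_on_inner)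

lemma continuous_on_matrix_mult [continuous_intros]:
  fixes u :: "'a::topological_space \<Rightarrow> real^'n" and A :: "real^'n^'m"
  shows "continuous_on S u \<Longrightarrow> continuous_on S (\<lambda>x. A *v u x)"
  by (rule bounded_linear.continuous_on[OF matrix_vector_mul_bounded_linear])

lemma continuous_on_hvec [continuous_intros]: "continuous_on S (hvec :: real^2 \<Rightarrow> real^3)"
proof -
  have "hvec = (\<lambda>x::real^2. x$1 *\<^sub>R axis 1 1 + x$2 *\<^sub>R axis 2 1 + (axis 3 1 :: real^3))"
    by (simp add: fun_eq_iff vec3_eq_iff axis_def)
  then show ?thesis by (rule ssubst) (intro continuous_intros)
qed

lemma continuous_on_frame_point [continuous_intros]:
  fixes p e f :: "real^3"
  shows "continuous_on S g \<Longrightarrow> continuous_on S (\<lambda>x. frame_point p e f (g x))"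
  unfolding frame_point_def scalar_mult_eq_scaleR by (intro continuous_intros)

lemma has_vector_derivative_vdot:
  fixes u v :: "real \<Rightarrow> real^'n"
  assumes "(u has_vector_derivative u') (at t)" "(v has_vector_derivative v') (at t)"
  shows "((\<lambda>t. vdot (u t) (v t)) has_vector_derivative vdot (u t) v' + vdot u' (v t)) (at t)"
  using bounded_bilinear.has_vector_derivative[OF bounded_bilinear_inner assms]
  by (simp add: inner_eq_vdot)

lemma has_vector_derivative_matrix_mult:
  fixes u :: "real \<Rightarrow> real^'n" and A :: "real^'n^'m"
  assumes "(u has_vector_derivative u') F"
  shows "((\<lambda>t. A *v u t) has_vector_derivative A *v u') F"
  by (rule bounded_linear.has_vector_derivative[OF matrix_vector_mul_bounded_linear assms])

lemma has_vector_derivative_frame_point: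
  fixes p e f :: "real^3"
  shows "(frame_point p e f has_vector_derivative e + (2 * t) *s f) (at t)"
  unfolding frame_point_def[abs_def] scalar_mult_eq_scaleR
  by (auto intro!: derivative_eq_intros simp: has_vector_derivative_def scaleR_add_right mult.commute)

text \<open>The derivative of a constant quadratic form. The value at 0 is a separate assumption
  because the filter \<open>at 0\<close> omits the point itself.\<close>

lemma quadric_velocity:
  fixes K :: "real^'n^'n"
  assumes K: "symmetric_matrix K" and \<gamma>: "(\<gamma> has_vector_derivative v) (at 0)"
    and c: "\<forall>\<^sub>F t in at 0. vdot (K *v \<gamma> t) (\<gamma> t) = c" "vdot (K *v \<gamma> 0) (\<gamma> 0) = c"
  shows "vdot (K *v \<gamma> 0) v = 0"
proof -
  let ?h = "\<lambda>t. vdot (K *v \<gamma> t) (\<gamma> t)"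
  have "(?h has_vector_derivative vdot (K *v \<gamma> 0) v + vdot (K *v v) (\<gamma> 0)) (at 0)"
    by (intro has_vector_derivative_vdot has_vector_derivative_matrix_mult \<gamma>)
  then have d: "DERIV ?h 0 :> 2 * vdot (K *v \<gamma> 0) v"
    by (simp add: has_real_derivative_iff_has_vector_derivative symmetric_vdot[OF K, of v])
  have "\<forall>\<^sub>F t in nhds 0. ?h t = c" using c by (simp add: eventually_nhds_conv_at)
  then have "DERIV ?h 0 :> 0 \<longleftrightarrow> DERIV (\<lambda>t. c) (0::real) :> 0" by (rule DERIV_cong_ev[OF refl _ refl])
  then have "DERIV ?h 0 :> 0" by simp
  then have "2 * vdot (K *v \<gamma> 0) v = 0" using d DERIV_unique by blast
  then show ?thesis by simp
qed

lemma span_singleton_scaleR: "c \<noteq> 0 \<Longrightarrow> span {c *\<^sub>R v} = span {v}"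
  using span_image_scale[of "{v}" "\<lambda>_. c"] by simp

section \<open>The hyperboloid model and its tangent planes\<close>

definition hyperbolic_plane :: "(real^3) set" where
  "hyperbolic_plane = {x. (x$3)\<^sup>2 - (x$1)\<^sup>2 - (x$2)\<^sup>2 = 1 \<and> x$3 > 0}"

lemma hyperbolic_plane_iff: "x \<in> hyperbolic_plane \<longleftrightarrow> lorentz x x = - 1 \<and> x$3 > 0"
  by (auto simp: hyperbolic_plane_def lorentz_def power2_eq_square)

definition lorentz_matrix :: "real^3^3" where
  "lorentz_matrix = vector [vector [1, 0, 0], vector [0, 1, 0], vector [0, 0, - 1]]"

lemma lorentz_matrix: "vdot (lorentz_matrix *v u) v = lorentz u v" "symmetric_matrix lorentz_matrix"
  by (simp_all add: lorentz_matrix_def lorentz_def matrix_vector_mult_3 vdot_3 symmetric_matrix_def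
      transpose_def vec3_eq_iff)

lemma lorentz_simps [simp]:
  "lorentz (u + v) w = lorentz u w + lorentz v w" "lorentz u (v + w) = lorentz u v + lorentz u w"
  "lorentz (c *s u) w = c * lorentz u w" "lorentz u (c *s w) = c * lorentz u w"
  "lorentz 0 w = 0"
  by (simp_all add: lorentz_def algebra_simps)

lemma lorentz_commute: "lorentz u v = lorentz v u"
  by (simp add: lorentz_def mult.commute)

lemma tangent_space_hyperbolic_plane:
  assumes y: "y \<in> hyperbolic_plane"
  shows "tangent_space hyperbolic_plane y = {n. lorentz y n = 0}"
proof (intro equalityI subsetI CollectI)
  fix n assume "n \<in> tangent_space hyperbolic_plane y"
  then obtain \<gamma> where \<gamma>: "\<gamma> 0 = y" "\<forall>\<^sub>F t in at 0. \<gamma> t \<in> hyperbolic_plane"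
    "(\<gamma> has_vector_derivative n) (at 0)"
    by (auto simp: tangent_space_def)
  have "\<forall>\<^sub>F t in at 0. vdot (lorentz_matrix *v \<gamma> t) (\<gamma> t) = - 1"
    using \<gamma>(2) by eventually_elim (simp add: lorentz_matrix hyperbolic_plane_iff)
  then have "vdot (lorentz_matrix *v \<gamma> 0) n = 0"
    using y \<gamma>(1) by (intro quadric_velocity[OF lorentz_matrix(2) \<gamma>(3)])
      (auto simp: lorentz_matrix hyperbolic_plane_iff)
  then show "lorentz y n = 0" by (simp add: lorentz_matrix \<gamma>(1))
next
  fix n assume "n \<in> {n. lorentz y n = 0}"
  then have n: "lorentz y n = 0" "lorentz n y = 0" by (simp_all add: lorentz_commute)
  have y': "lorentz y y = - 1" "y$3 > 0" using y by (simp_all add: hyperbolic_plane_iff)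
  define c where "c = lorentz n n"
  \<comment> \<open>The straight path \<open>y + t n\<close> has Lorentz square
    \<open>- (1 - t^2 c)\<close>; \<open>r\<close> pushes it radially back to the hyperboloid. As
    \<open>r\<close> has derivative zero at 0, the velocity stays \<open>n\<close>.\<close>
  define r where "r t = inverse (sqrt (1 - t\<^sup>2 * c))" for t
  define \<gamma> where "\<gamma> t = r t *\<^sub>R (y + t *\<^sub>R n)" for t
  have "((\<lambda>t. 1 - t\<^sup>2 * c) \<longlongrightarrow> 1) (at 0)" "((\<lambda>t. y$3 + t * n$3) \<longlongrightarrow> y$3) (at 0)"
    by (auto intro!: tendsto_eq_intros)
  from order_tendstoD(1)[OF this(1), of 0] order_tendstoD(1)[OF this(2), of 0]
  have "\<forall>\<^sub>F t in at 0. 1 - t\<^sup>2 * c > 0" "\<forall>\<^sub>F t in at 0. y$3 + t * n$3 > 0"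
    using y'(2) by simp_all
  then have "\<forall>\<^sub>F t in at 0. \<gamma> t \<in> hyperbolic_plane"
  proof eventually_elim
    case (elim t)
    have "lorentz (\<gamma> t) (\<gamma> t) = (r t)\<^sup>2 * lorentz (y + t *s n) (y + t *s n)"
      by (simp only: \<gamma>_def scalar_mult_eq_scaleR[symmetric] lorentz_simps(3,4) power2_eq_square mult.assoc)
    also have "lorentz (y + t *s n) (y + t *s n) = - (1 - t\<^sup>2 * c)"
      by (simp add: n y' power2_eq_square flip: c_def)
    finally have "lorentz (\<gamma> t) (\<gamma> t) = - ((r t)\<^sup>2 * (1 - t\<^sup>2 * c))"
      by (simp only: mult_minus_right)
    also have "\<dots> = - 1" using elim(1) by (simp add: r_def power_inverse)
    finally show ?case using elim by (simp add: hyperbolic_plane_iff \<gamma>_def r_def)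
  qed
  moreover have "(\<gamma> has_vector_derivative n) (at 0)"
  proof -
    have r: "(r has_real_derivative 0) (at 0)"
      unfolding r_def[abs_def] by (auto intro!: derivative_eq_intros)
    have "((\<lambda>t. y + t *\<^sub>R n) has_vector_derivative n) (at 0)"
      by (auto intro!: derivative_eq_intros simp: has_vector_derivative_def)
    from has_vector_derivative_scaleR[OF r this] show ?thesis
      by (simp add: \<gamma>_def[abs_def] r_def)
  qed
  moreover have "\<gamma> 0 = y" by (simp add: \<gamma>_def r_def)
  ultimately show "n \<in> tangent_space hyperbolic_plane y" by (auto simp: tangent_space_def)
qed

section \<open>Arcs of the conic in the affine chart\<close>

locale affine_arc =
  fixes C :: "real^3^3" and p e f :: "real^3" and a :: real
  assumes frame: "conic_frame C p e f a"
    and affine: "\<And>t. t \<in> {0<..<1} \<Longrightarrow> frame_point p e f t $ 3 > 0"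
begin

abbreviation "\<phi> \<equiv> frame_point p e f"

definition chart :: "real \<Rightarrow> real^2" where
  "chart t = vector [\<phi> t $ 1 / \<phi> t $ 3, \<phi> t $ 2 / \<phi> t $ 3]"

definition arc :: "(real^2) set" where
  "arc = chart ` {0<..<1}"

lemma hvec_chart: "t \<in> {0<..<1} \<Longrightarrow> hvec (chart t) = (1 / \<phi> t $ 3) *s \<phi> t"
  using affine[of t] by (simp add: chart_def vec3_eq_iff)

lemma arc_subset: "arc \<subseteq> affine_conic C"
  by (auto simp: arc_def affine_conic_vdot hvec_chart mv_simps frame_point_isotropic[OF frame])

lemma coord_hvec_chart: "t \<in> {0<..<1} \<Longrightarrow> frame_coord C e f (hvec (chart t)) = t"
  using affine[of t] by (simp add: hvec_chart frame_coord_point[OF frame])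

lemma inj_chart: "inj_on chart {0<..<1}"
  by (metis coord_hvec_chart inj_onI)

text \<open>The parameter is \<open>- <C e, x> / (2 <C f, x>)\<close>; extending the fraction by
  \<open><C f, x>\<close> makes its denominator a square, so \<open>0 < t < 1\<close> becomes two
  inequalities without division. They are open in the whole plane and exclude the point at parameter
  infinity.\<close>

lemma arc_eq: "arc = affine_conic C \<inter> {x. 0 < - (vdot (C *v e) (hvec x) * vdot (C *v f) (hvec x))
    \<and> - (vdot (C *v e) (hvec x) * vdot (C *v f) (hvec x)) < 2 * (vdot (C *v f) (hvec x))\<^sup>2}"
    (is "_ = _ \<inter> {x. 0 < ?A x \<and> ?A x < ?B x}")
proof (intro equalityI subsetI)
  fix x assume x: "x \<in> arc"
  then obtain t where t: "t \<in> {0<..<1}" "x = chart t" by (auto simp: arc_def)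
  define s where "s = 1 / \<phi> t $ 3"
  have s: "s > 0" using affine[OF t(1)] by (simp add: s_def)
  have AB: "?A x = 2 * a\<^sup>2 * s\<^sup>2 * t" "?B x = 2 * a\<^sup>2 * s\<^sup>2"
    by (simp_all add: t(2) hvec_chart[OF t(1)] frame_point_pairing[OF frame] power2_eq_square
        flip: s_def)
  have "2 * a\<^sup>2 * s\<^sup>2 > 0" using s conic_frameD(2)[OF frame] by simp
  then have pos: "0 < 2 * a\<^sup>2 * s\<^sup>2 * t" "2 * a\<^sup>2 * s\<^sup>2 * t < 2 * a\<^sup>2 * s\<^sup>2 * 1"
    using t(1) mult_strict_left_mono[of t 1 "2 * a\<^sup>2 * s\<^sup>2"] by (auto intro: mult_pos_pos)
  have "0 < ?A x" unfolding AB by (rule pos)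
  moreover have "?A x < ?B x" unfolding AB using pos(2) by (simp only: mult_1_right)
  ultimately show "x \<in> affine_conic C \<inter> {x. 0 < ?A x \<and> ?A x < ?B x}"
    using x arc_subset by blast
next
  fix x assume "x \<in> affine_conic C \<inter> {x. 0 < ?A x \<and> ?A x < ?B x}"
  then have x: "vdot (C *v hvec x) (hvec x) = 0" "0 < ?A x" "?A x < ?B x"
    by (auto simp: affine_conic_vdot)
  then have nz: "vdot (C *v f) (hvec x) \<noteq> 0" by auto
  define t where "t = frame_coord C e f (hvec x)"
  have "t = ?A x / ?B x" using nz by (simp add: t_def frame_coord_def power2_eq_square)
  moreover have "u / v \<in> {0<..<1}" if "0 < u" "u < v" for u v :: real using that by simp
  ultimately have t: "t \<in> {0<..<1}" using x(2,3) by presburger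
  have "hvec x = (vdot (C *v f) (hvec x) / a) *s \<phi> t"
    unfolding t_def by (rule isotropic_eq_frame_point[OF frame x(1) nz])
  then have "x = chart t" using hvec_chart[OF t] by (rule hvec_multiple_unique)
  then show "x \<in> arc" using t by (auto simp: arc_def)
qed

lemma open_arc: "open_arc_of (affine_conic C) arc"
proof -
  have "open {x. 0 < - (vdot (C *v e) (hvec x) * vdot (C *v f) (hvec x))
    \<and> - (vdot (C *v e) (hvec x) * vdot (C *v f) (hvec x)) < 2 * (vdot (C *v f) (hvec (x::real^2)))\<^sup>2}"
    by (intro open_Collect_conj open_Collect_less continuous_intros)
  then have "openin (top_of_set (affine_conic C)) arc"
    unfolding arc_eq by (rule openin_open_Int)
  moreover have "homeomorphism {0<..<1} arc chart (\<lambda>x. frame_coord C e f (hvec x))"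
  proof (rule homeomorphismI)
    have "chart = (\<lambda>t. (\<phi> t $ 1 / \<phi> t $ 3) *\<^sub>R axis 1 1 + (\<phi> t $ 2 / \<phi> t $ 3) *\<^sub>R axis 2 1)"
      by (simp add: fun_eq_iff vec2_eq_iff axis_def chart_def)
    moreover have "\<phi> t $ 3 \<noteq> 0" if "t \<in> {0<..<1}" for t using affine[OF that] by simp
    ultimately show "continuous_on {0<..<1} chart"
      by (auto intro!: continuous_intros)
    have "vdot (C *v f) (hvec x) \<noteq> 0" if "x \<in> arc" for x using that arc_eq by auto
    then show "continuous_on arc (\<lambda>x. frame_coord C e f (hvec x))"
      unfolding frame_coord_def by (auto intro!: continuous_intros)
  qed (auto simp: arc_def coord_hvec_chart)
  ultimately show ?thesis
    unfolding open_arc_of_def using homeomorphic_def homeomorphic_sym by blast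
qed

end

text \<open>\<open>negative\<close> places the arc in the Klein disk of \<open>M\<close>, and
  \<open>upper\<close> picks the sheet of the hyperboloid after \<open>P\<close> has brought
  \<open>M\<close> to normal form.\<close>

locale lorentz_arc = affine_arc +
  fixes M P :: "real^3^3"
  assumes invertible_C: "invertible C"
    and symmetric_M: "symmetric_matrix M" and invertible_M: "invertible M"
    and invertible_P: "invertible P"
    and form: "\<And>u v. vdot (M *v u) v = lorentz (P *v u) (P *v v)"
    and negative: "\<And>t. t \<in> {0<..<1} \<Longrightarrow> vdot (M *v \<phi> t) (\<phi> t) < 0"
    and upper: "\<And>t. t \<in> {0<..<1} \<Longrightarrow> (P *v \<phi> t) $ 3 > 0"
begin

definition weight :: "real \<Rightarrow> real" where
  "weight t = inverse (sqrt (- vdot (M *v \<phi> t) (\<phi> t)))"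

definition lift :: "real \<Rightarrow> real^3" where
  "lift t = weight t *\<^sub>R (P *v \<phi> t)"

definition lifted_arc :: "(real^3) set" where
  "lifted_arc = lift ` {0<..<1}"

lemma weight_pos: "t \<in> {0<..<1} \<Longrightarrow> weight t > 0"
  using negative[of t] by (simp add: weight_def)

lemma lift_in_hyperbolic_plane: "t \<in> {0<..<1} \<Longrightarrow> lift t \<in> hyperbolic_plane"
proof -
  assume t: "t \<in> {0<..<1}"
  have "lorentz (lift t) (lift t) = (weight t)\<^sup>2 * vdot (M *v \<phi> t) (\<phi> t)"
    by (simp add: lift_def form power2_eq_square flip: scalar_mult_eq_scaleR)
  also have "\<dots> = - 1"
    using negative[OF t] by (simp add: weight_def power_inverse)
  finally show ?thesis
    using upper[OF t] weight_pos[OF t] by (simp add: hyperbolic_plane_iff lift_def)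
qed

lemma P_inv_lift: "matrix_inv P *v lift t = weight t *s \<phi> t"
  by (simp add: lift_def mv_simps invertible_P flip: scalar_mult_eq_scaleR)

lemma coord_lift: "t \<in> {0<..<1} \<Longrightarrow> frame_coord C e f (matrix_inv P *v lift t) = t"
  using weight_pos[of t] by (simp add: P_inv_lift frame_coord_point[OF frame])

text \<open>The explicit derivative serves the \<open>C1\<close> condition. It cannot vanish: the
  radial factor changes the velocity only along the position vector, which is independent of the
  velocity of the frame point.\<close>

lemma lift_derivative:
  obtains D where "continuous_on {0<..<1} D"
    "\<And>t. t \<in> {0<..<1} \<Longrightarrow> (lift has_vector_derivative D t) (at t)"
    "\<And>t. t \<in> {0<..<1} \<Longrightarrow> D t \<noteq> 0"
proof -
  define \<phi>' where "\<phi>' t = e + (2 * t) *s f" for t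
  define q where "q t = - vdot (M *v \<phi> t) (\<phi> t)" for t
  define q' where "q' t = - (2 * vdot (M *v \<phi> t) (\<phi>' t))" for t
  define w' where "w' t = - (inverse (sqrt (q t)) * (inverse (sqrt (q t)) / 2 * q' t) * inverse (sqrt (q t)))" for t
  define D where "D t = weight t *\<^sub>R (P *v \<phi>' t) + w' t *\<^sub>R (P *v \<phi> t)" for t
  have q: "q t > 0" if "t \<in> {0<..<1}" for t using negative[OF that] by (simp add: q_def)
  have \<phi>: "(\<phi> has_vector_derivative \<phi>' t) (at t)" for t
    unfolding \<phi>'_def by (rule has_vector_derivative_frame_point)
  have "((\<lambda>t. vdot (M *v \<phi> t) (\<phi> t)) has_vector_derivative
      vdot (M *v \<phi> t) (\<phi>' t) + vdot (M *v \<phi>' t) (\<phi> t)) (at t)" for t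
    by (intro has_vector_derivative_vdot has_vector_derivative_matrix_mult \<phi>)
  then have "(q has_vector_derivative q' t) (at t)" for t
    unfolding q_def[abs_def] q'_def
    by (auto intro!: derivative_eq_intros simp: symmetric_vdot[OF symmetric_M, of "\<phi>' t" "\<phi> t"])
  then have q': "(q has_real_derivative q' t) (at t)" for t
    by (simp add: has_real_derivative_iff_has_vector_derivative)
  have w: "(weight has_real_derivative w' t) (at t)" if "t \<in> {0<..<1}" for t
  proof -
    have "((\<lambda>t. sqrt (q t)) has_real_derivative inverse (sqrt (q t)) / 2 * q' t) (at t)"
      by (rule DERIV_chain2[OF DERIV_real_sqrt[OF q[OF that]] q'])
    moreover have "weight = (\<lambda>t. inverse (sqrt (q t)))" by (simp add: fun_eq_iff weight_def q_def)
    ultimately show ?thesis using q[OF that] unfolding w'_def by (simp only:) (rule DERIV_inverse', auto)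
  qed
  have "continuous_on {0<..<1} D"
    unfolding D_def w'_def weight_def q_def[symmetric]
    unfolding q_def q'_def \<phi>'_def scalar_mult_eq_scaleR
    by (intro continuous_intros ballI) (use negative in force)+
  moreover have "(lift has_vector_derivative D t) (at t)" if "t \<in> {0<..<1}" for t
    unfolding lift_def[abs_def] D_def
    by (intro has_vector_derivative_scaleR w that has_vector_derivative_matrix_mult \<phi>)
  moreover have "D t \<noteq> 0" if t: "t \<in> {0<..<1}" for t
  proof
    note F = conic_frameD[OF frame]
    assume "D t = 0"
    then have "P *v (weight t *s \<phi>' t + w' t *s \<phi> t) = 0"
      by (simp add: D_def mv_simps flip: scalar_mult_eq_scaleR)
    then have 0: "weight t *s \<phi>' t + w' t *s \<phi> t = 0"
      using invertible_mult_eq_0[OF invertible_P] by blast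
    \<comment> \<open>\<open>C *v f\<close> annihilates \<open>\<phi>' t\<close> but not
      \<open>\<phi> t\<close>, so it isolates \<open>w' t\<close>; afterwards \<open>C *v e\<close>
      detects \<open>\<phi>' t\<close>.\<close>
    have "vdot (C *v f) (weight t *s \<phi>' t + w' t *s \<phi> t) = 0" unfolding 0 by simp
    then have "w' t = 0" using F by (simp add: \<phi>'_def frame_point_pairing[OF frame])
    then have "\<phi>' t = 0" using 0 weight_pos[OF t] by simp
    then have "vdot (C *v e) (\<phi>' t) = 0" by simp
    then show False using F by (simp add: \<phi>'_def)
  qed
  ultimately show thesis by (rule that)
qed

lemma regular_lifted_arc: "regular_curve lifted_arc"
proof -
  obtain D where D: "continuous_on {0<..<1} D"
    "\<And>t. t \<in> {0<..<1} \<Longrightarrow> (lift has_vector_derivative D t) (at t)"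
    "\<And>t. t \<in> {0<..<1} \<Longrightarrow> D t \<noteq> 0"
    using lift_derivative by blast
  have "homeomorphism {0<..<1} lifted_arc lift (\<lambda>y. frame_coord C e f (matrix_inv P *v y))"
  proof (rule homeomorphismI)
    show "continuous_on {0<..<1} lift"
      using D(2) by (meson continuous_at_imp_continuous_on has_vector_derivative_continuous)
    have "vdot (C *v f) (matrix_inv P *v y) \<noteq> 0" if "y \<in> lifted_arc" for y
    proof -
      from that obtain t where t: "t \<in> {0<..<1}" "y = lift t" by (auto simp: lifted_arc_def)
      show ?thesis
        using weight_pos[OF t(1)] conic_frameD(2)[OF frame]
        by (simp add: t(2) P_inv_lift frame_point_pairing[OF frame])
    qed
    then show "continuous_on lifted_arc (\<lambda>y. frame_coord C e f (matrix_inv P *v y))"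
      unfolding frame_coord_def by (auto intro!: continuous_intros)
  qed (auto simp: lifted_arc_def coord_lift)
  moreover have "lift C1_differentiable_on {0<..<1}"
    unfolding C1_differentiable_on_def using D(1,2) by blast
  moreover have "vector_derivative lift (at t) \<noteq> 0" if "t \<in> {0<..<1}" for t
    using D(2,3)[OF that] by (simp add: vector_derivative_at)
  ultimately show ?thesis
    unfolding regular_curve_def by (metis openin_subtopology_self)
qed

text \<open>Pulled back by \<open>P\<close>, the curve lies both on the hyperboloid where
  \<open>M\<close> has value -1 and on the cone over \<open>C\<close>; each quadric contributes one
  linear equation.\<close>

lemma tangent_space_lifted_arc:
  assumes t: "t \<in> {0<..<1}" and v: "v \<in> tangent_space lifted_arc (lift t)"
  shows "vdot (M *v \<phi> t) (matrix_inv P *v v) = 0" "vdot (C *v \<phi> t) (matrix_inv P *v v) = 0"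
proof -
  from v obtain \<gamma> where \<gamma>: "\<gamma> 0 = lift t" "\<forall>\<^sub>F s in at 0. \<gamma> s \<in> lifted_arc"
    "(\<gamma> has_vector_derivative v) (at 0)"
    by (auto simp: tangent_space_def)
  let ?\<gamma> = "\<lambda>s. matrix_inv P *v \<gamma> s"
  have d: "(?\<gamma> has_vector_derivative matrix_inv P *v v) (at 0)"
    by (rule has_vector_derivative_matrix_mult[OF \<gamma>(3)])
  have M: "vdot (M *v (matrix_inv P *v y)) (matrix_inv P *v y) = - 1" if "y \<in> lifted_arc" for y
    using that lift_in_hyperbolic_plane
    by (auto simp: form invertible_P lifted_arc_def hyperbolic_plane_iff)
  have C: "vdot (C *v (matrix_inv P *v y)) (matrix_inv P *v y) = 0" if "y \<in> lifted_arc" for y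
    using that by (auto simp: lifted_arc_def P_inv_lift mv_simps frame_point_isotropic[OF frame])
  have lift: "lift t \<in> lifted_arc" using t by (simp add: lifted_arc_def)
  have w: "weight t \<noteq> 0" using weight_pos[OF t] by simp
  have "vdot (M *v ?\<gamma> 0) (matrix_inv P *v v) = 0"
    using \<gamma>(2) by (intro quadric_velocity[OF symmetric_M d]) (auto elim: eventually_mono simp: M \<gamma>(1) lift)
  then show "vdot (M *v \<phi> t) (matrix_inv P *v v) = 0"
    using w by (simp add: \<gamma>(1) P_inv_lift mv_simps)
  have "vdot (C *v ?\<gamma> 0) (matrix_inv P *v v) = 0"
    using \<gamma>(2) by (intro quadric_velocity[OF conic_frameD(1)[OF frame] d])
      (auto elim: eventually_mono simp: C \<gamma>(1) lift)
  then show "vdot (C *v \<phi> t) (matrix_inv P *v v) = 0"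
    using w by (simp add: \<gamma>(1) P_inv_lift mv_simps)
qed

text \<open>\<open>M\<close> is negative at \<open>\<phi> t\<close> while \<open>C\<close> vanishes
  there, so the two polars differ. Hence the two equations for a tangent vector have a
  one-dimensional solution space, and the point and its \<open>M\<close>-pole span a plane.\<close>

lemma polars_independent:
  assumes t: "t \<in> {0<..<1}"
  shows "xprod (M *v \<phi> t) (C *v \<phi> t) \<noteq> 0" "xprod (\<phi> t) (matrix_inv M *v (C *v \<phi> t)) \<noteq> 0"
proof -
  have "\<phi> t \<noteq> 0" using affine[OF t] by auto
  then have C0: "C *v \<phi> t \<noteq> 0" using invertible_C invertible_mult_eq_0 by blast
  have M: "M *v \<phi> t \<noteq> k *s (C *v \<phi> t)" for k
    using negative[OF t] frame_point_isotropic[OF frame, of t] by auto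
  then show "xprod (M *v \<phi> t) (C *v \<phi> t) \<noteq> 0" using xprod_eq_0D C0 by blast
  show "xprod (\<phi> t) (matrix_inv M *v (C *v \<phi> t)) \<noteq> 0"
  proof
    assume "xprod (\<phi> t) (matrix_inv M *v (C *v \<phi> t)) = 0"
    moreover have "matrix_inv M *v (C *v \<phi> t) \<noteq> 0"
      using C0 invertible_inv[OF invertible_M] invertible_mult_eq_0 by blast
    ultimately obtain k where "\<phi> t = k *s (matrix_inv M *v (C *v \<phi> t))"
      using xprod_eq_0D by blast
    from arg_cong[OF this, of "\<lambda>v. M *v v"] show False
      using M by (simp add: mv_simps invertible_M)
  qed
qed

text \<open>\<open>m\<close> is the covector of the join of the point with the \<open>M\<close>-pole
  of its \<open>C\<close>-tangent. The point and its hyperbolic normal span the Lorentz complement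
  of the velocity, and that plane is identified with the kernel of \<open>m\<close>.\<close>

lemma normal_line_lifted_arc:
  assumes t: "t \<in> {0<..<1}" and m: "m \<noteq> 0" "vdot m (\<phi> t) = 0"
      "vdot m (matrix_inv M *v (C *v \<phi> t)) = 0"
  shows "dproj (lift t) (normal_line hyperbolic_plane lorentz lifted_arc (lift t)) =
    (*v) P ` {u. vdot m u = 0}"
proof -
  let ?y = "lift t"
  obtain D where D: "continuous_on {0<..<1} D" "\<And>t. t \<in> {0<..<1} \<Longrightarrow> (lift has_vector_derivative D t) (at t)"
    "\<And>t. t \<in> {0<..<1} \<Longrightarrow> D t \<noteq> 0"
    using lift_derivative by blast
  define w where "w = D t"
  have w0: "w \<noteq> 0" using D(3) t by (simp add: w_def)
  have wT: "w \<in> tangent_space lifted_arc ?y"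
  proof -
    have "(lift has_vector_derivative w) (at (t + 0))" using D(2)[OF t] by (simp add: w_def)
    moreover have "((+) t has_vector_derivative 1) (at 0)" by (auto intro!: derivative_eq_intros)
    ultimately have "((\<lambda>s. lift (t + s)) has_vector_derivative w) (at 0)"
      using vector_diff_chain_at[of "(+) t" 1 0 lift w] by (simp add: o_def)
    moreover have "\<forall>\<^sub>F s in at 0. t + s \<in> {0<..<1}"
    proof -
      have "((\<lambda>s. t + s) \<longlongrightarrow> t) (at 0)" by (auto intro!: tendsto_eq_intros)
      then show ?thesis using t by (intro topological_tendstoD) auto
    qed
    then have "\<forall>\<^sub>F s in at 0. lift (t + s) \<in> lifted_arc"
      by eventually_elim (simp add: lifted_arc_def)
    ultimately show ?thesis
      unfolding tangent_space_def by (intro CollectI exI[of _ "\<lambda>s. lift (t + s)"]) auto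
  qed
  have y: "lorentz ?y ?y = - 1" "?y \<in> hyperbolic_plane"
    using lift_in_hyperbolic_plane[OF t] by (auto simp: hyperbolic_plane_iff)
  have lor: "lorentz ?y v = weight t * vdot (M *v \<phi> t) (matrix_inv P *v v)" for v
    by (simp add: form invertible_P lift_def flip: scalar_mult_eq_scaleR)
  define \<tau> where "\<tau> = matrix_inv P *v w"
  have P\<tau>: "P *v \<tau> = w" by (simp add: \<tau>_def invertible_P)
  have \<tau>: "vdot (M *v \<phi> t) \<tau> = 0" "vdot (C *v \<phi> t) \<tau> = 0" "\<tau> \<noteq> 0"
    using tangent_space_lifted_arc[OF t wT] w0 P\<tau> by (auto simp: \<tau>_def)
  have yw: "lorentz ?y w = 0" by (simp add: lor \<tau>(1) flip: \<tau>_def)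
  have T: "\<exists>k. v = k *s w" if v: "v \<in> tangent_space lifted_arc ?y" for v
  proof -
    obtain k where "matrix_inv P *v v = k *s \<tau>"
      using orthogonal_to_two_multiple[OF polars_independent(1)[OF t] \<tau> tangent_space_lifted_arc[OF t v]] .
    from arg_cong[OF this, of "\<lambda>u. P *v u"] have "v = k *s w"
      by (simp add: invertible_P mv_simps P\<tau>)
    then show ?thesis ..
  qed
  have normal: "normal_line hyperbolic_plane lorentz lifted_arc ?y
      = {n. lorentz ?y n = 0 \<and> lorentz n w = 0}"
  proof -
    have "(\<forall>v\<in>tangent_space lifted_arc ?y. lorentz n v = 0) \<longleftrightarrow> lorentz n w = 0" for n
    proof
      assume n: "lorentz n w = 0"
      show "\<forall>v\<in>tangent_space lifted_arc ?y. lorentz n v = 0"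
      proof
        fix v assume "v \<in> tangent_space lifted_arc ?y"
        then obtain k where "v = k *s w" using T by blast
        then show "lorentz n v = 0" using n by simp
      qed
    qed (use wT in blast)
    then show ?thesis
      by (simp add: normal_line_def tangent_space_hyperbolic_plane[OF y(2)])
  qed
  have "span (insert ?y {n. lorentz ?y n = 0 \<and> lorentz n w = 0}) = {k. lorentz k w = 0}"
  proof (intro equalityI span_minimal)
    show "subspace {k. lorentz k w = 0}"
      by (auto simp: subspace_def simp flip: scalar_mult_eq_scaleR)
    show "{k. lorentz k w = 0} \<subseteq> span (insert ?y {n. lorentz ?y n = 0 \<and> lorentz n w = 0})"
    proof
      fix k assume "k \<in> {k. lorentz k w = 0}"
      \<comment> \<open>Since \<open>lorentz ?y ?y = - 1\<close>, adding this multiple of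
        \<open>?y\<close> projects \<open>k\<close> onto the tangent plane of the
        hyperboloid.\<close>
      then have n: "k + lorentz ?y k *s ?y \<in> {n. lorentz ?y n = 0 \<and> lorentz n w = 0}"
        by (simp add: yw y(1))
      have "k = (k + lorentz ?y k *s ?y) - lorentz ?y k *\<^sub>R ?y"
        by (simp add: scalar_mult_eq_scaleR)
      also have "\<dots> \<in> span (insert ?y {n. lorentz ?y n = 0 \<and> lorentz n w = 0})"
        using n by (intro span_diff span_scale span_base) auto
      finally show "k \<in> span (insert ?y {n. lorentz ?y n = 0 \<and> lorentz n w = 0})" .
    qed
  qed (auto simp: yw)
  also have "\<dots> = (*v) P ` {u. vdot m u = 0}"
  proof -
    \<comment> \<open>The covector \<open>M *v \<tau>\<close> vanishes on the point, as \<tau> is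
      tangent to the hyperboloid, and on the \<open>M\<close>-pole, as \<tau> is tangent to the cone
      over \<open>C\<close>. So does \<open>m\<close>, hence the two are proportional.\<close>
    have "vdot (\<phi> t) (M *v \<tau>) = 0"
      using \<tau>(1) symmetric_vdot[OF symmetric_M] vdot_commute by metis
    moreover have "vdot (matrix_inv M *v (C *v \<phi> t)) (M *v \<tau>) = 0"
    proof -
      have "vdot (M *v \<tau>) (matrix_inv M *v (C *v \<phi> t)) = vdot (C *v \<phi> t) \<tau>"
        by (subst symmetric_vdot[OF symmetric_M]) (simp add: invertible_M)
      then show ?thesis using \<tau>(2) by (simp add: vdot_commute)
    qed
    ultimately obtain k where k: "M *v \<tau> = k *s m"
      using orthogonal_to_two_multiple[OF polars_independent(2)[OF t], of m "M *v \<tau>"] m by (metis vdot_commute)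
    have "M *v \<tau> \<noteq> 0" using invertible_mult_eq_0[OF invertible_M] \<tau>(3) by blast
    then have k0: "k \<noteq> 0" using k by auto
    have iff: "lorentz (P *v u) w = 0 \<longleftrightarrow> vdot m u = 0" for u
    proof -
      have "lorentz (P *v u) w = vdot (M *v \<tau>) u"
        by (metis P\<tau> form lorentz_commute)
      then show ?thesis using k k0 by simp
    qed
    show ?thesis
    proof (intro equalityI subsetI)
      fix x assume "x \<in> {k. lorentz k w = 0}"
      then have "vdot m (matrix_inv P *v x) = 0"
        using iff[of "matrix_inv P *v x"] by (simp add: invertible_P)
      then show "x \<in> (*v) P ` {u. vdot m u = 0}"
        by (intro image_eqI[of _ _ "matrix_inv P *v x"]) (simp_all add: invertible_P)
    qed (auto simp: iff)
  qed
  finally show ?thesis unfolding dproj_def normal .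
qed

lemma proj_lift:
  assumes t: "t \<in> {0<..<1}"
  shows "proj (lift t) = projective_map P (proj (hvec (chart t)))"
proof -
  have "projective_map P (proj (hvec (chart t))) = span ((*v) P ` {hvec (chart t)})"
    unfolding projective_map_def proj_def
    by (rule linear_span_image[symmetric]) (rule matrix_vector_mul_linear)
  also have "(*v) P ` {hvec (chart t)} = {(1 / \<phi> t $ 3) *\<^sub>R (P *v \<phi> t)}"
    by (simp add: hvec_chart[OF t] scalar_mult_eq_scaleR matrix_vector_mult_scaleR)
  also have "span \<dots> = span {P *v \<phi> t}"
    using affine[OF t] by (simp add: span_singleton_scaleR)
  also have "\<dots> = span {lift t}"
    unfolding lift_def using weight_pos[OF t] by (simp add: span_singleton_scaleR)
  finally show ?thesis by (simp add: proj_def)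
qed

lemma inj_proj_lift:
  assumes t: "t \<in> {0<..<1}" "s \<in> {0<..<1}" and eq: "proj (lift t) = proj (lift s)"
  shows "t = s"
proof -
  have "lift t \<in> span {lift s}" using eq by (metis proj_def insertI1 span_base)
  then obtain k where k: "lift t = k *s lift s"
    by (auto simp: span_singleton scalar_mult_eq_scaleR)
  from arg_cong[OF this, of "\<lambda>v. matrix_inv P *v v"]
  have *: "matrix_inv P *v lift t = (k * weight s) *s \<phi> s"
    by (simp add: mv_simps P_inv_lift vector_smult_assoc)
  have "k \<noteq> 0" using k lift_in_hyperbolic_plane[OF t(1)] by (auto simp: hyperbolic_plane_iff)
  then have "k * weight s \<noteq> 0" using weight_pos[OF t(2)] by simp
  then have "frame_coord C e f (matrix_inv P *v lift t) = s"
    unfolding * by (rule frame_coord_point[OF frame])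
  then show ?thesis using coord_lift[OF t(1)] by simp
qed

text \<open>The hypothesis expresses, through the covector \<open>m\<close>, that \<open>N x\<close>
  is the join of \<open>x\<close> with the \<open>M\<close>-pole of the tangent.\<close>

lemma projection_of_lifted_arc:
  assumes N: "\<And>x. x \<in> arc \<Longrightarrow> \<exists>m. m \<noteq> 0 \<and> plane_over (N x) = {w. vdot m w = 0} \<and>
    vdot m (hvec x) = 0 \<and> vdot m (matrix_inv M *v (C *v hvec x)) = 0"
  shows "projection_of_billiard hyperbolic_plane lorentz lifted_arc P arc N"
  unfolding projection_of_billiard_def
proof (intro conjI ballI impI)
  show "lifted_arc \<subseteq> hyperbolic_plane"
    using lift_in_hyperbolic_plane by (auto simp: lifted_arc_def)
  show "regular_curve lifted_arc" by (rule regular_lifted_arc)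
  show "bij_betw proj lifted_arc ((\<lambda>x. projective_map P (proj (hvec x))) ` arc)"
    unfolding bij_betw_def
  proof
    show "inj_on proj lifted_arc"
      unfolding inj_on_def lifted_arc_def using inj_proj_lift by blast
    show "proj ` lifted_arc = (\<lambda>x. projective_map P (proj (hvec x))) ` arc"
      unfolding lifted_arc_def arc_def image_image using proj_lift by (intro image_cong) auto
  qed
  fix x y assume x: "x \<in> arc" and y: "y \<in> lifted_arc"
    and eq: "proj y = projective_map P (proj (hvec x))"
  obtain t where t: "t \<in> {0<..<1}" "x = chart t" using x by (auto simp: arc_def)
  obtain s where s: "s \<in> {0<..<1}" "y = lift s" using y by (auto simp: lifted_arc_def)
  have "s = t" using eq proj_lift[OF t(1)] s t by (intro inj_proj_lift) auto
  then have yt: "y = lift t" using s by simp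
  obtain m where m: "m \<noteq> 0" "plane_over (N x) = {w. vdot m w = 0}" "vdot m (hvec x) = 0"
    "vdot m (matrix_inv M *v (C *v hvec x)) = 0"
    using N[OF x] by blast
  have "vdot m (\<phi> t) = 0" "vdot m (matrix_inv M *v (C *v \<phi> t)) = 0"
    using m(3,4) affine[OF t(1)] by (simp_all add: t(2) hvec_chart[OF t(1)] mv_simps)
  then show "dproj y (normal_line hyperbolic_plane lorentz lifted_arc y) =
      projective_map P (plane_over (N x))"
    unfolding yt m(2) projective_map_def using normal_line_lifted_arc[OF t(1) m(1)] by blast
qed

end

text \<open>What holds for small positive parameters holds on all of \<open>{0<..<1}\<close> after
  rescaling the parameter; \<open>p\<close> becomes an end of the open arc.\<close>

lemma conic_frame_shrink:
  fixes p e f :: "real^3"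
  assumes fr: "conic_frame C p e f a" and ev: "\<forall>\<^sub>F t in at_right 0. Q (frame_point p e f t)"
  obtains e' f' a' where "conic_frame C p e' f' a'"
    "\<And>t. t \<in> {0<..<1} \<Longrightarrow> Q (frame_point p e' f' t)"
proof -
  obtain d where d: "d > 0" "\<And>t. 0 < t \<Longrightarrow> t < d \<Longrightarrow> Q (frame_point p e f t)"
    using ev unfolding eventually_at_right_field by blast
  have "Q (frame_point p (d *s e) (d\<^sup>2 *s f) t)" if "t \<in> {0<..<1}" for t
    unfolding frame_point_scale using that d(1) by (intro d(2)) auto
  then show thesis using conic_frame_scale[OF fr, of d] d(1) that by blast
qed

lemma frame_point_0 [simp]: "frame_point p e f 0 = p"
  by (simp add: frame_point_def)

lemma eventually_frame_point_pos:
  fixes p e f :: "real^3"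
  assumes "continuous_on UNIV g" "g p > (0::real)"
  shows "\<forall>\<^sub>F t in at_right 0. g (frame_point p e f t) > 0"
proof -
  have "continuous_on UNIV (\<lambda>t. g (frame_point p e f t))"
    by (rule continuous_on_compose2[OF assms(1)]) (auto intro!: continuous_intros)
  then have "((\<lambda>t. g (frame_point p e f t)) \<longlongrightarrow> g (frame_point p e f 0)) (at 0 within UNIV)"
    unfolding continuous_on_def by blast
  then have "((\<lambda>t. g (frame_point p e f t)) \<longlongrightarrow> g p) (at_right 0)"
    unfolding frame_point_0 by (rule tendsto_within_subset) simp
  then show ?thesis using assms(2) by (rule order_tendstoD)
qed

text \<open>Guarantees that a point is left after the finitely many base points are removed; a
  one-sided arc at any real point suffices.\<close>

lemma infinite_affine_conic:
  assumes C: "nonlinear_real_conic C"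
  shows "infinite (affine_conic C)"
proof -
  have C': "symmetric_matrix C" "invertible C" and "affine_conic C \<noteq> {}"
    using C by (auto simp: nonlinear_real_conic_def regular_conic_matrix_def)
  then obtain x where "vdot (C *v hvec x) (hvec x) = 0" by (auto simp: affine_conic_vdot)
  then obtain e f a where fr: "conic_frame C (hvec x) e f a"
    using conic_frame_exists[OF C' hvec_neq_0] by blast
  have "\<forall>\<^sub>F t in at_right 0. frame_point (hvec x) e f t $ 3 > 0"
    by (rule eventually_frame_point_pos[where g = "\<lambda>v. v$3"]) (auto intro!: continuous_intros)
  then obtain e' f' a' where "conic_frame C (hvec x) e' f' a'"
    "\<And>t. t \<in> {0<..<1} \<Longrightarrow> frame_point (hvec x) e' f' t $ 3 > 0"
    using conic_frame_shrink[OF fr, of "\<lambda>v. v$3 > 0"] by blast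
  then interpret affine_arc C "hvec x" e' f' a' by unfold_locales
  have "infinite arc"
    unfolding arc_def using inj_chart by (simp add: finite_image_iff infinite_Ioo)
  then show ?thesis using arc_subset finite_subset by blast
qed

lemma polar_normal_plane:
  assumes C: "regular_conic_matrix C" and S: "regular_conic_matrix S"
    and x: "x \<in> punctured_conic C S"
  obtains m where "m \<noteq> 0" "plane_over (polar_normal C S x) = {w. vdot m w = 0}"
    "vdot m (hvec x) = 0" "vdot m (matrix_inv S *v (C *v hvec x)) = 0"
proof -
  define l n where "l = C *v hvec x" and "n = matrix_inv S *v l"
  have lx: "vdot l (hvec x) = 0" and nl: "vdot n l \<noteq> 0"
    using x by (auto simp: punctured_conic_def base_points_eq[OF C S] affine_conic_vdot n_def l_def)
  have Nx: "polar_normal C S x = {x + w | w. vdot n (xprod (hvec x) (dvec w)) = 0}"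
    by (simp add: polar_normal_def n_def l_def)
  have e: "vector [1, 0] \<noteq> (0 :: real^2)" by (simp add: vec2_eq_iff)
  have "polar_normal C S x \<in> lines_through x"
    unfolding Nx by (rule polar_normal_line(2)[OF nl lx e refl])
  then obtain v where v: "v \<noteq> 0" "polar_normal C S x = {x + t *\<^sub>R v | t. True}"
    by (auto simp: lines_through_def)
  have "vdot n (xprod (hvec x) (dvec v)) = 0"
    using polar_normal_line(1)[OF nl lx v] Nx by blast
  moreover have "xprod (hvec x) (dvec v) \<noteq> 0"
    using v(1) by (intro xprod_hvec_dvec_neq_0) (auto simp: vec3_eq_iff vec2_eq_iff)
  ultimately show thesis
    using that plane_over_line[OF v(1), of x] v(2) vdot_commute[of n]
    by (simp add: n_def l_def)
qed

text \<open>All requirements on the arc are open and hold at one point that is not a base point, so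
  a short arc starting there satisfies them.\<close>

lemma polar_normal_hyperbolic_lift:
  assumes C: "nonlinear_real_conic C" and S: "regular_conic_matrix S"
    and distinct: "complex_conic (cmat S) \<noteq> complex_conic (cmat C)"
    and N: "\<And>x. x \<in> punctured_conic C S \<Longrightarrow> N x = polar_normal C S x"
  obtains P C' \<Gamma> where "invertible P" "C' \<noteq> {}" "C' \<subseteq> punctured_conic C S"
    "open_arc_of (affine_conic C) C'"
    "projection_of_billiard hyperbolic_plane lorentz \<Gamma> P C' N"
proof -
  have C0: "regular_conic_matrix C" using C by (simp add: nonlinear_real_conic_def)
  note C' = regular_conic_matrixD[OF C0] and S' = regular_conic_matrixD[OF S]
  have "infinite (punctured_conic C S)"
    using infinite_affine_conic[OF C] base_points_card[OF C0 S distinct]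
    by (simp add: punctured_conic_def Diff_infinite_finite)
  then obtain x where x: "x \<in> punctured_conic C S" using infinite_imp_nonempty by blast
  define p where "p = hvec x"
  define q where "q v = vdot (matrix_inv S *v (C *v v)) (C *v v)" for v
  have p: "p \<noteq> 0" "vdot (C *v p) p = 0" "q p \<noteq> 0" "p $ 3 > 0"
    using x by (auto simp: punctured_conic_def base_points_eq[OF C0 S] affine_conic_vdot p_def q_def)
  have detC: "det C \<noteq> 0" using C'(2) by (simp add: invertible_det_nz)
  \<comment> \<open>In odd dimension exactly one of \<open>C\<close>, \<open>- C\<close> has
    negative determinant; the sign in \<open>T\<close> makes the dual form positive at the tangent
    covector of \<open>p\<close>.\<close>
  define \<kappa> where "\<kappa> = - sgn (det C)"
  define C1 T where "C1 = \<kappa> *\<^sub>R C" and "T = sgn (q p) *\<^sub>R matrix_inv S"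
  have \<kappa>: "\<kappa> \<noteq> 0" "\<kappa> * \<kappa> = 1" using detC by (auto simp: \<kappa>_def sgn_if)
  have C1v: "C1 *v v = \<kappa> *s (C *v v)" for v by (simp add: C1_def)
  note inv_C1 = matrix_inv_multiple[OF C1v \<kappa>(1) C'(2)]
  have sym_C1: "symmetric_matrix C1" and sym_T: "symmetric_matrix T"
    using C'(1) S'(3) by (simp_all add: C1_def T_def symmetric_matrix_def transpose_scalar)
  have det_C1: "det C1 < 0"
  proof -
    have "det C1 = \<kappa> ^ 3 * det C"
      by (simp add: C1_def det_3 power3_eq_cube algebra_simps)
    also have "\<kappa> ^ 3 = \<kappa>" using \<kappa>(2) by (simp add: power3_eq_cube)
    finally show ?thesis using detC by (simp add: \<kappa>_def sgn_if split: if_splits)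
  qed
  have "vdot (T *v (C1 *v p)) (C1 *v p) = sgn (q p) * (\<kappa> * \<kappa>) * q p"
    by (simp add: C1v T_def q_def mv_simps)
  also have "\<dots> > 0" using p(3) \<kappa>(2) by (simp add: sgn_if)
  finally have pos: "vdot (T *v (C1 *v p)) (C1 *v p) > 0" .
  have p1: "vdot (C1 *v p) p = 0" using p(2) by (simp add: C1v)
  obtain \<epsilon> M b where M: "symmetric_matrix M" "invertible M" "det M < 0"
    "\<And>v. matrix_inv M *v v = matrix_inv C1 *v v + \<epsilon> *s (T *v v)"
    "vdot (M *v p) p < 0" "vdot (M *v b) b > 0"
    using lorentz_pencil_member[OF sym_C1 inv_C1(1) det_C1 sym_T p1 pos] by metis
  obtain P where P: "invertible P" "(P *v p) $ 3 > 0"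
    "\<And>u v. vdot (M *v u) v = lorentz (P *v u) (P *v v)"
    using lorentz_normal_form[OF M(1,3,5,6)] by metis
  obtain e f a where fr: "conic_frame C p e f a"
    using conic_frame_exists[OF C'(1,2) p(1,2)] by metis
  define good where "good v \<longleftrightarrow> v $ 3 > 0 \<and> (P *v v) $ 3 > 0 \<and> vdot (M *v v) v < 0 \<and> q v \<noteq> 0" for v
  have "\<forall>\<^sub>F t in at_right 0. frame_point p e f t $ 3 > 0"
    by (rule eventually_frame_point_pos[where g = "\<lambda>v. v$3"]) (auto intro!: continuous_intros p)
  moreover have "\<forall>\<^sub>F t in at_right 0. (P *v frame_point p e f t) $ 3 > 0"
    by (rule eventually_frame_point_pos[where g = "\<lambda>v. (P *v v) $ 3"])
      (auto intro!: continuous_intros P)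
  moreover have "\<forall>\<^sub>F t in at_right 0. - vdot (M *v frame_point p e f t) (frame_point p e f t) > 0"
    using M(5) by (intro eventually_frame_point_pos[where g = "\<lambda>v. - vdot (M *v v) v"])
      (auto intro!: continuous_intros)
  \<comment> \<open>The factor \<open>q p\<close> turns nonvanishing of \<open>q\<close> into a
    positivity statement, whatever its sign at \<open>p\<close>.\<close>
  moreover have "\<forall>\<^sub>F t in at_right 0. q p * q (frame_point p e f t) > 0"
    using p(3) unfolding q_def
    by (intro eventually_frame_point_pos[where g = "\<lambda>v. q p * q v", unfolded q_def])
      (auto intro!: continuous_intros simp: zero_less_mult_iff linorder_neq_iff)
  ultimately have "\<forall>\<^sub>F t in at_right 0. good (frame_point p e f t)"
    unfolding good_def by eventually_elim auto
  then obtain e' f' a' where fr': "conic_frame C p e' f' a'"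
    and good: "\<And>t. t \<in> {0<..<1} \<Longrightarrow> good (frame_point p e' f' t)"
    using conic_frame_shrink[OF fr, of good] by blast
  interpret lorentz_arc C p e' f' a' M P
    using fr' good C'(2) M(1,2) P(1,3) unfolding good_def by unfold_locales auto
  have sub: "arc \<subseteq> punctured_conic C S"
  proof
    fix y assume y: "y \<in> arc"
    then obtain t where t: "t \<in> {0<..<1}" "y = chart t" by (auto simp: arc_def)
    have "q (hvec y) \<noteq> 0"
      using good[OF t(1)] unfolding t(2) hvec_chart[OF t(1)] by (auto simp: good_def q_def mv_simps)
    then show "y \<in> punctured_conic C S"
      using y arc_subset by (auto simp: punctured_conic_def base_points_eq[OF C0 S] q_def)
  qed
  have ne: "arc \<noteq> {}" by (simp add: arc_def)
  have "projection_of_billiard hyperbolic_plane lorentz lifted_arc P arc N"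
  proof (rule projection_of_lifted_arc)
    fix y assume "y \<in> arc"
    then have y: "y \<in> punctured_conic C S" using sub by blast
    obtain m where m: "m \<noteq> 0" "plane_over (polar_normal C S y) = {w. vdot m w = 0}"
      "vdot m (hvec y) = 0" "vdot m (matrix_inv S *v (C *v hvec y)) = 0"
      using polar_normal_plane[OF C0 S y] by metis
    \<comment> \<open>The \<open>M\<close>-pole of the tangent is a combination of
      \<open>hvec y\<close> and the \<open>S\<close>-pole, and \<open>m\<close> vanishes on
      both.\<close>
    have "vdot m (matrix_inv M *v (C *v hvec y)) = 0"
      by (simp add: M(4) inv_C1(2) C'(2) T_def m)
    then show "\<exists>m. m \<noteq> 0 \<and> plane_over (N y) = {w. vdot m w = 0} \<and>
        vdot m (hvec y) = 0 \<and> vdot m (matrix_inv M *v (C *v hvec y)) = 0"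
      using m N[OF y] by auto
  qed
  then show thesis using P(1) ne sub open_arc by (rule_tac that)
qed

section \<open>Assembly of the three statements\<close>

theorem proposition1p26:
  fixes C S U A :: "real^3^3" and N :: "real^2 \<Rightarrow> (real^2) set"
  assumes C: "nonlinear_real_conic C"
    and S: "regular_conic_matrix S"
    and distinct: "complex_conic (cmat S) \<noteq> complex_conic (cmat C)"
    and N: "dual_pencil_billiard C S N"
    and U: "symmetric_matrix U" "dual_conic C = complex_conic (cmat U)"
    and A: "symmetric_matrix A" "dual_conic S = complex_conic (cmat A)"
  shows
    "(finite (base_points C S) \<and> card (base_points C S) \<le> 4 \<and>
      (\<exists>M. symmetric_matrix M \<and> field_defined_by C (punctured_conic C S) M N)) \<and>
     ((\<forall>M. symmetric_matrix M \<and> complex_conic (cmat M) \<in> dual_pencil U A \<and>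
           complex_conic (cmat M) \<noteq> complex_conic (cmat C)
         \<longrightarrow> field_defined_by C (punctured_conic C S) M N) \<and>
      (\<exists>M. symmetric_matrix M \<and> invertible M \<and>
           complex_conic (cmat M) \<in> dual_pencil U A \<and>
           complex_conic (cmat M) \<noteq> complex_conic (cmat C) \<and>
           field_defined_by C (punctured_conic C S) M N)) \<and>
     (\<exists>P C' \<Sigma> g \<Gamma>. invertible P \<and>
        C' \<noteq> {} \<and> C' \<subseteq> punctured_conic C S \<and> finite_union_of_arcs (affine_conic C) C' \<and>
        constant_curvature_surface \<Sigma> g \<and>
        projection_of_billiard \<Sigma> g \<Gamma> P C' N)"
proof -
  have C0: "regular_conic_matrix C" using C by (simp add: nonlinear_real_conic_def)
  note S' = regular_conic_matrixD[OF S]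
  have normal: "N x = polar_normal C S x" if "x \<in> punctured_conic C S" for x
    using dual_pencil_billiard_normal[OF C0 S N that] .
  obtain u where u: "\<And>v. U *v v = u *s (matrix_inv C *v v)"
    using dual_conic_matrix[OF C0 U] by metis
  obtain a where a: "a \<noteq> 0" "\<And>v. A *v v = a *s (matrix_inv S *v v)"
    using dual_conic_matrix[OF S A] by metis
  have pencil: "field_defined_by C (punctured_conic C S) M N"
    if M: "symmetric_matrix M" "complex_conic (cmat M) \<in> dual_pencil U A"
      "complex_conic (cmat M) \<noteq> complex_conic (cmat C)" for M
  proof -
    obtain \<alpha> \<beta> where ab: "invertible M" "\<beta> \<noteq> 0"
      "\<And>v. matrix_inv M *v v = \<alpha> *s (matrix_inv C *v v) + \<beta> *s (matrix_inv S *v v)"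
      using dual_pencil_inverse[OF C0 U(1) u A(1) a(2) M] by metis
    then show ?thesis using normal by (rule polar_normal_field_defined_by[OF C0 S])
  qed
  \<comment> \<open>\<open>S\<close> is the member at infinity because \<open>A\<close> is a
    multiple of its inverse. Regular and different from \<open>C\<close>, it is the witness for both
    existence claims about matrices.\<close>
  have S_mem: "complex_conic (cmat S) \<in> dual_pencil U A"
  proof -
    have "A = a *\<^sub>R matrix_inv S" by (rule matrix_eqI_vector) (simp add: a(2))
    then have A_mult: "cmat A *v v = of_real a *s (cmat (matrix_inv S) *v v)" for v
      by (simp add: vec_eq_iff matrix_vector_mult_def sum_distrib_left mult.assoc)
    have a0: "complex_of_real a \<noteq> 0" using a(1) by simp
    note inv = matrix_inv_multiple[OF A_mult a0 invertible_cmat_inv(1)[OF S'(4)]]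
    have "matrix_inv (cmat (matrix_inv S)) = cmat S"
      by (simp add: invertible_cmat_inv(2)[OF S'(4)] matrix_inv_inv S'(2))
    then have "complex_conic (matrix_inv (cmat A)) = complex_conic (cmat S)"
      using inv(2) a0 by (intro complex_conic_multiple[of _ "1 / of_real a"]) auto
    then show ?thesis using inv(1) by (auto simp: dual_pencil_def)
  qed
  have S_field: "field_defined_by C (punctured_conic C S) S N"
    using pencil S'(1) S_mem distinct by blast
  have "\<exists>P C' \<Sigma> g \<Gamma>. invertible P \<and>
        C' \<noteq> {} \<and> C' \<subseteq> punctured_conic C S \<and> finite_union_of_arcs (affine_conic C) C' \<and>
        constant_curvature_surface \<Sigma> g \<and> projection_of_billiard \<Sigma> g \<Gamma> P C' N"
  proof -
    obtain P C' \<Gamma> where *: "invertible P" "C' \<noteq> {}" "C' \<subseteq> punctured_conic C S"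
      "open_arc_of (affine_conic C) C'"
      "projection_of_billiard hyperbolic_plane lorentz \<Gamma> P C' N"
      using polar_normal_hyperbolic_lift[OF C S distinct normal] by metis
    have "finite_union_of_arcs (affine_conic C) C'"
      unfolding finite_union_of_arcs_def by (rule exI[of _ "{C'}"]) (simp add: *(4))
    moreover have "constant_curvature_surface hyperbolic_plane lorentz"
      by (simp add: constant_curvature_surface_def hyperbolic_plane_def lorentz_def fun_eq_iff)
    ultimately show ?thesis using * by blast
  qed
  then show ?thesis
    using base_points_card[OF C0 S distinct] pencil S_field S_mem S' distinct by blast
qed

end
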